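(* Let $n\ge 5$ and $s$ be integers with $1<s<n/2$, and let $q=\lfloor n/s\rfloor$ and $r=n-qs$ (so $0\le r<s$, $q\ge 2$). For an integer $x$ let $\epsilon(x)=1$ if $x$ is odd and $\epsilon(x)=0$ if $x$ is even. Then: (a) if $2\le s\le \sqrt{n}-1$, then $$\frac{n^2-\epsilon(n)}{8(s+1)}\le \frac{\pi(C_n(1,s))}{2}\le \overrightarrow{\pi}(C_n(1,s))\le \frac{(n-r)(n+r+2)+s^2}{8s};$$ (b) if $s=\sqrt{n}$, then $$\frac{\sqrt{n}\,(n-1)}{8}\le \frac{\pi(C_n(1,s))}{2}\le \overrightarrow{\pi}(C_n(1,s))\le \frac{\sqrt{n}\,(n-\epsilon(s))}{8};$$ (c) if $\sqrt{n}+1\le s<n/2$, then $$\max\left\{\frac{n^2-\epsilon(n)}{8(s+1)},\ \frac{(n-1)(\sqrt{2n}-7)^3}{24n}\right\}\le \frac{\pi(C_n(1,s))}{2}\le \overrightarrow{\pi}(C_n(1,s))\le \frac{s^2(n+r+2)-\epsilon(s)(n-r)}{8s}.$$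
   Context: For $n\ge 3$, $\mathbb{Z}_n$ is the additive group of integers mod $n$. The circulant graph $C_n(1,s)$ has vertex set $\mathbb{Z}_n$, with $i,j$ adjacent iff $i-j\in\{\pm1,\pm s\}$ (mod $n$). An arc is an ordered pair of adjacent vertices. An all-to-all routing $R$ of a graph $G$ is a set of oriented paths containing exactly one path $P_{x,y}$ from $x$ to $y$ for each ordered pair $(x,y)$ of distinct vertices. The load of an edge $e$ under $R$ is the number of paths of $R$ using $e$ (in either direction); the load of an arc $a$ is the number of paths of $R$ traversing $a$ in its direction. $\pi(G,R)$ (resp. $\overrightarrow{\pi}(G,R)$) is the maximum edge load (resp. maximum arc load) under $R$; the edge-forwarding index is $\pi(G)=\min_R\pi(G,R)$ and the arc-forwarding index is $\overrightarrow{\pi}(G)=\min_R\overrightarrow{\pi}(G,R)$, minima over all all-to-all routings $R$. *)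

theory Defs
  imports Complex_Main "HOL-Number_Theory.Cong" "Graph_Theory.Graph_Theory"
begin

text \<open>
  A simple graph is a symmetric loop-free pair digraph (locale \<^locale>\<open>pair_graph\<close>): its arcs are the
  ordered pairs of adjacent vertices. \<open>\<int>\<^sub>n\<close> is represented by the residues \<open>{0..<n}\<close>.
\<close>

definition circulant2 :: "int \<Rightarrow> int \<Rightarrow> int pair_pre_digraph" where
  "circulant2 n s =
     \<lparr> pverts = {0..<n},
       parcs = {(i, j). i \<in> {0..<n} \<and> j \<in> {0..<n} \<and>
                        (\<exists>d \<in> {1, -1, s, -s}. [i - j = d] (mod n))} \<rparr>"

lemma pair_graph_circulant2:
  assumes "1 < s" "s < n"
  shows "pair_graph (circulant2 n s)"
proof
  have "parcs (circulant2 n s) \<subseteq> {0..<n} \<times> {0..<n}"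
    by (auto simp: circulant2_def)
  then show "finite (parcs (circulant2 n s))"
    by (rule finite_subset) simp
next
  fix e assume "e \<in> parcs (circulant2 n s)"
  then obtain d where "[fst e - snd e = d] (mod n)" "d \<in> {1, -1, s, -s}"
    by (auto simp: circulant2_def)
  moreover have "\<not> n dvd d" if "d \<in> {1, -1, s, -s}" for d
    using that assms zdvd_not_zless[of 1 n] zdvd_not_zless[of s n] by auto
  ultimately have "\<not> [fst e - snd e = 0] (mod n)"
    by (metis cong_0_iff cong_sym cong_trans)
  then show "fst e \<noteq> snd e"
    by (metis cong_refl diff_self)
next
  have "[j - i = - d] (mod n)" if "[i - j = d] (mod n)" for i j d :: int
    using that cong_minus_minus_iff[of "i - j" d n] by simp
  then show "symmetric (with_proj (circulant2 n s))"
    unfolding symmetric_def by (fastforce simp: circulant2_def intro!: symI)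
qed (auto simp: circulant2_def)

text \<open>
  A path is given by its list of arcs; \<^const>\<open>pre_digraph.apath\<close> requires its vertices to be distinct.
  For distinct end vertices the list is nonempty and hence determines both ends.
\<close>

definition all_to_all_routing :: "'a pair_pre_digraph \<Rightarrow> ('a \<times> 'a) list set \<Rightarrow> bool" where
  "all_to_all_routing G R \<longleftrightarrow>
     (\<forall>p \<in> R. \<exists>x \<in> pverts G. \<exists>y \<in> pverts G. x \<noteq> y \<and> pre_digraph.apath (with_proj G) x p y) \<and>
     (\<forall>x \<in> pverts G. \<forall>y \<in> pverts G. x \<noteq> y \<longrightarrow>
        (\<exists>!p. p \<in> R \<and> pre_digraph.apath (with_proj G) x p y))"

definition arc_load :: "('a \<times> 'a) list set \<Rightarrow> 'a \<times> 'a \<Rightarrow> nat" where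
  "arc_load R a = card {p \<in> R. a \<in> set p}"

definition edges :: "'a pair_pre_digraph \<Rightarrow> 'a set set" where
  "edges G = {{u, v} | u v. (u, v) \<in> parcs G}"

definition edge_load :: "('a \<times> 'a) list set \<Rightarrow> 'a set \<Rightarrow> nat" where
  "edge_load R e = card {p \<in> R. \<exists>(u, v) \<in> set p. {u, v} = e}"

definition max_arc_load :: "'a pair_pre_digraph \<Rightarrow> ('a \<times> 'a) list set \<Rightarrow> nat" where
  "max_arc_load G R = Max (arc_load R ` parcs G)"

definition max_edge_load :: "'a pair_pre_digraph \<Rightarrow> ('a \<times> 'a) list set \<Rightarrow> nat" where
  "max_edge_load G R = Max (edge_load R ` edges G)"

text \<open>
  On \<^typ>\<open>nat\<close>, \<^const>\<open>Inf\<close> of a nonempty set is its least element; a connected graph has a routing,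
  so the infima below are minima for such graphs.
\<close>

definition arc_forwarding_index :: "'a pair_pre_digraph \<Rightarrow> nat" where
  "arc_forwarding_index G = (INF R \<in> {R. all_to_all_routing G R}. max_arc_load G R)"

definition edge_forwarding_index :: "'a pair_pre_digraph \<Rightarrow> nat" where
  "edge_forwarding_index G = (INF R \<in> {R. all_to_all_routing G R}. max_edge_load G R)"

definition eps :: "int \<Rightarrow> real" where
  "eps x = (if odd x then 1 else 0)"

end

theory Submission
  imports Defs
begin

text \<open>
  Upper bounds: send \<open>x\<close> to \<open>x + z\<close>, for \<open>1 \<le> z \<le> n/2\<close>, by \<open>b\<close> steps \<open>+s\<close> followed by \<open>\<bar>a\<bar>\<close> steps
  \<open>\<plusminus>1\<close>, where \<open>z = a + b s\<close> is the division with least absolute remainder, and use the opposite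
  steps for \<open>-z\<close>. By translation invariance every arc of type \<open>\<plusminus>1\<close> has load at most
  \<open>\<Sum> \<bar>a\<bar>\<close> and every arc of type \<open>\<plusminus>s\<close> load at most \<open>\<Sum> b\<close>, sums over \<open>1 \<le> z \<le> n/2\<close>.

  Lower bounds: give the edges of type \<open>1\<close> and \<open>s\<close> weights \<open>w\<^sub>1\<close> and \<open>w\<^sub>s\<close>. Double counting bounds
  \<open>\<pi> (w\<^sub>1 + w\<^sub>s)\<close> below by the sum over \<open>z\<close> of the weighted distances from \<open>0\<close> to \<open>z\<close>. Weights \<open>(1, s)\<close>
  give the cyclic distance; weights \<open>(1, 1)\<close> give the graph distance, which for \<open>n = s\<^sup>2\<close> is attained by
  the paths above, and in general is controlled by the size of \<open>\<ell>\<^sub>1\<close>-balls in \<open>\<int>\<^sup>2\<close>.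
\<close>

section \<open>Routings and forwarding indices\<close>

definition distinct_pairs :: "'a set \<Rightarrow> ('a \<times> 'a) set" where
  "distinct_pairs V = {(x, y). x \<in> V \<and> y \<in> V \<and> x \<noteq> y}"

lemma finite_distinct_pairs: "finite V \<Longrightarrow> finite (distinct_pairs V)"
  by (rule finite_subset[of _ "V \<times> V"]) (auto simp: distinct_pairs_def)

text \<open>A path between distinct vertices is a nonempty arc list, from which both ends can be
  read off. So a routing is the same as a choice of one path for each ordered pair.\<close>

lemma (in pair_wf_digraph) all_to_all_routing_iff:
  "all_to_all_routing G R \<longleftrightarrow>
     (\<exists>P. R = case_prod P ` distinct_pairs (pverts G) \<and>
          (\<forall>(x, y) \<in> distinct_pairs (pverts G). apath x (P x y) y))"
proof
  assume R: "all_to_all_routing G R"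
  define P where "P x y = (THE p. p \<in> R \<and> apath x p y)" for x y
  have P: "P x y \<in> R \<and> apath x (P x y) y"
    if "x \<in> pverts G" "y \<in> pverts G" "x \<noteq> y" for x y
    unfolding P_def by (rule theI') (use R that in \<open>auto simp: all_to_all_routing_def\<close>)
  have eq: "p = P x y"
    if "p \<in> R" "apath x p y" "x \<in> pverts G" "y \<in> pverts G" "x \<noteq> y" for p x y
    using R P[OF that(3-5)] that unfolding all_to_all_routing_def by blast
  have "R \<subseteq> case_prod P ` distinct_pairs (pverts G)"
  proof
    fix p assume "p \<in> R"
    with R obtain x y where "x \<in> pverts G" "y \<in> pverts G" "x \<noteq> y" "apath x p y"
      by (auto simp: all_to_all_routing_def)
    with eq[OF \<open>p \<in> R\<close>] show "p \<in> case_prod P ` distinct_pairs (pverts G)"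
      by (force simp: distinct_pairs_def)
  qed
  with P show "\<exists>P. R = case_prod P ` distinct_pairs (pverts G) \<and>
      (\<forall>(x, y) \<in> distinct_pairs (pverts G). apath x (P x y) y)"
    by (intro exI[of _ P]) (auto simp: distinct_pairs_def)
next
  assume "\<exists>P. R = case_prod P ` distinct_pairs (pverts G) \<and>
      (\<forall>(x, y) \<in> distinct_pairs (pverts G). apath x (P x y) y)"
  then obtain P where R: "R = case_prod P ` distinct_pairs (pverts G)"
    and P: "\<And>x y. x \<in> pverts G \<Longrightarrow> y \<in> pverts G \<Longrightarrow> x \<noteq> y \<Longrightarrow> apath x (P x y) y"
    by (auto simp: distinct_pairs_def)
  show "all_to_all_routing G R"
    unfolding all_to_all_routing_def
  proof (intro conjI ballI impI)
    fix p assume "p \<in> R"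
    then show "\<exists>x\<in>pverts G. \<exists>y\<in>pverts G. x \<noteq> y \<and> apath x p y"
      using P by (auto simp: R distinct_pairs_def)
  next
    fix x y assume xy: "x \<in> pverts G" "y \<in> pverts G" "x \<noteq> y"
    show "\<exists>!p. p \<in> R \<and> apath x p y"
    proof (rule ex1I[of _ "P x y"])
      show "P x y \<in> R \<and> apath x (P x y) y"
        using xy P by (force simp: R distinct_pairs_def)
      fix p assume p: "p \<in> R \<and> apath x p y"
      then obtain u v where "p = P u v" "u \<in> pverts G" "v \<in> pverts G" "u \<noteq> v"
        by (auto simp: R distinct_pairs_def)
      with p P[of u v] show "p = P x y"
        using apath_ends[of u p v x y] by auto
    qed
  qed
qed

text \<open>Loads count elements of a set of paths; injectivity turns them into counts of vertex
  pairs.\<close>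

lemma (in pair_wf_digraph) inj_on_paths:
  assumes "\<forall>(x, y) \<in> distinct_pairs (pverts G). apath x (P x y) y"
  shows "inj_on (case_prod P) (distinct_pairs (pverts G))"
proof (rule inj_onI, clarify)
  fix u v x y assume *: "(u, v) \<in> distinct_pairs (pverts G)" "(x, y) \<in> distinct_pairs (pverts G)"
    and eq: "P u v = P x y"
  from * have "apath u (P u v) v" "apath x (P x y) y" "u \<noteq> v"
    using assms by (auto simp: distinct_pairs_def)
  then show "u = x \<and> v = y"
    using apath_ends eq by metis
qed

lemma card_filter_image:
  assumes "inj_on f S"
  shows "card {p \<in> f ` S. Q p} = card {x \<in> S. Q (f x)}"
proof -
  have "{p \<in> f ` S. Q p} = f ` {x \<in> S. Q (f x)}"
    by auto
  then show ?thesis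
    using assms by (metis (no_types, lifting) card_image inj_on_subset mem_Collect_eq subsetI)
qed

text \<open>Shortcutting a walk to a path only removes arcs, so it cannot increase any load.\<close>

lemma (in pair_fin_digraph) routing_of_walks:
  assumes W: "\<And>x y. (x, y) \<in> distinct_pairs (pverts G) \<Longrightarrow> awalk x (W x y) y"
  obtains R where "all_to_all_routing G R"
    and "\<And>a. arc_load R a \<le> card {(x, y) \<in> distinct_pairs (pverts G). a \<in> set (W x y)}"
proof -
  define P where "P x y = awalk_to_apath (W x y)" for x y
  define R where "R = case_prod P ` distinct_pairs (pverts G)"
  have P: "\<forall>(x, y) \<in> distinct_pairs (pverts G). apath x (P x y) y"
    using W by (auto simp: P_def intro: apath_awalk_to_apath)
  have sub: "set (P x y) \<subseteq> set (W x y)" if "(x, y) \<in> distinct_pairs (pverts G)" for x y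
    unfolding P_def by (rule awalk_to_apath_subset[OF W[OF that]])
  have fin: "finite (distinct_pairs (pverts G))"
    by (rule finite_distinct_pairs) (rule pair_finite_verts)
  show ?thesis
  proof (rule that)
    show "all_to_all_routing G R"
      unfolding all_to_all_routing_iff using P R_def by blast
    fix a
    have "arc_load R a = card {xy \<in> distinct_pairs (pverts G). a \<in> set (case_prod P xy)}"
      unfolding arc_load_def R_def by (rule card_filter_image[OF inj_on_paths[OF P]])
    also have "\<dots> \<le> card {(x, y) \<in> distinct_pairs (pverts G). a \<in> set (W x y)}"
      by (rule card_mono) (use fin sub in \<open>auto intro: finite_subset[OF _ fin]\<close>)
    finally show "arc_load R a \<le> card {(x, y) \<in> distinct_pairs (pverts G). a \<in> set (W x y)}" .
  qed
qed

lemma (in pair_fin_digraph) finite_routing: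
  assumes "all_to_all_routing G R"
  shows "finite R"
  using assms finite_distinct_pairs[OF pair_finite_verts] by (auto simp: all_to_all_routing_iff)

lemma (in pair_fin_digraph) finite_edges: "finite (edges G)"
proof -
  have "edges G = (\<lambda>(u, v). {u, v}) ` parcs G"
    by (auto simp: edges_def)
  then show ?thesis
    by (simp add: pair_finite_arcs)
qed

text \<open>A path that uses an edge contains one of its two opposite arcs, and both are arcs by
  symmetry.\<close>

lemma (in pair_graph) max_edge_load_le:
  assumes R: "all_to_all_routing G R" and ne: "parcs G \<noteq> {}"
  shows "max_edge_load G R \<le> 2 * max_arc_load G R"
proof -
  have "edge_load R e \<le> 2 * max_arc_load G R" if "e \<in> edges G" for e
  proof -
    from that obtain u v where e: "e = {u, v}" "(u, v) \<in> parcs G"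
      by (auto simp: edges_def)
    then have arcs: "(u, v) \<in> parcs G" "(v, u) \<in> parcs G"
      by (auto intro: arcs_symmetric)
    have "{p \<in> R. \<exists>(x, y) \<in> set p. {x, y} = e} \<subseteq>
        {p \<in> R. (u, v) \<in> set p} \<union> {p \<in> R. (v, u) \<in> set p}"
      by (auto simp: e doubleton_eq_iff)
    then have "edge_load R e \<le> card ({p \<in> R. (u, v) \<in> set p} \<union> {p \<in> R. (v, u) \<in> set p})"
      unfolding edge_load_def by (rule card_mono[rotated]) (use finite_routing[OF R] in auto)
    also have "\<dots> \<le> arc_load R (u, v) + arc_load R (v, u)"
      unfolding arc_load_def by (rule card_Un_le)
    also have "arc_load R (u, v) \<le> max_arc_load G R"
      unfolding max_arc_load_def by (rule Max_ge) (use arcs pair_finite_arcs in auto)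
    also have "arc_load R (v, u) \<le> max_arc_load G R"
      unfolding max_arc_load_def by (rule Max_ge) (use arcs pair_finite_arcs in auto)
    finally show ?thesis
      by simp
  qed
  moreover have "edges G \<noteq> {}"
    using ne by (auto simp: edges_def)
  ultimately show ?thesis
    unfolding max_edge_load_def using finite_edges by (subst Max_le_iff) auto
qed

lemma edge_forwarding_index_attained:
  assumes "all_to_all_routing G R"
  obtains R' where "all_to_all_routing G R'" "edge_forwarding_index G = max_edge_load G R'"
  using assms Inf_nat_def1[of "max_edge_load G ` {R. all_to_all_routing G R}"]
  by (auto simp: edge_forwarding_index_def)

lemma arc_forwarding_index_attained:
  assumes "all_to_all_routing G R"
  obtains R' where "all_to_all_routing G R'" "arc_forwarding_index G = max_arc_load G R'"
  using assms Inf_nat_def1[of "max_arc_load G ` {R. all_to_all_routing G R}"]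
  by (auto simp: arc_forwarding_index_def)

lemma arc_forwarding_index_le:
  "all_to_all_routing G R \<Longrightarrow> arc_forwarding_index G \<le> max_arc_load G R"
  unfolding arc_forwarding_index_def by (rule cINF_lower) auto

lemma edge_forwarding_index_le:
  "all_to_all_routing G R \<Longrightarrow> edge_forwarding_index G \<le> max_edge_load G R"
  unfolding edge_forwarding_index_def by (rule cINF_lower) auto

lemma (in pair_graph) edge_forwarding_index_le_twice_arc_forwarding_index:
  assumes "all_to_all_routing G R" and "parcs G \<noteq> {}"
  shows "edge_forwarding_index G \<le> 2 * arc_forwarding_index G"
proof -
  obtain R' where R': "all_to_all_routing G R'" "arc_forwarding_index G = max_arc_load G R'"
    using arc_forwarding_index_attained assms(1) by blast
  then show ?thesis
    using edge_forwarding_index_le[OF R'(1)] max_edge_load_le[OF R'(1) assms(2)] by simp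
qed

text \<open>Double counting of the pairs (path, edge on the path), weighted by the edge.\<close>

lemma (in pair_fin_digraph) sum_path_weights_le:
  fixes w :: "'a set \<Rightarrow> real" and d :: "'a \<Rightarrow> 'a \<Rightarrow> real"
  assumes R: "all_to_all_routing G R"
    and w: "\<And>e. e \<in> edges G \<Longrightarrow> 0 \<le> w e"
    and d: "\<And>x p y. apath x p y \<Longrightarrow> x \<noteq> y \<Longrightarrow> d x y \<le> sum w ((\<lambda>(u, v). {u, v}) ` set p)"
  shows "(\<Sum>(x, y) \<in> distinct_pairs (pverts G). d x y) \<le> max_edge_load G R * sum w (edges G)"
proof -
  define D where "D = distinct_pairs (pverts G)"
  from R obtain P where R_eq: "R = case_prod P ` D"
    and P: "\<forall>(x, y) \<in> D. apath x (P x y) y"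
    by (auto simp: all_to_all_routing_iff D_def)
  have fin: "finite D"
    unfolding D_def by (rule finite_distinct_pairs) (rule pair_finite_verts)
  define uses where "uses xy e \<longleftrightarrow> (\<exists>(u, v) \<in> set (case_prod P xy). {u, v} = e)" for xy e
  have "(\<Sum>(x, y) \<in> D. d x y) \<le> (\<Sum>xy \<in> D. \<Sum>e \<in> {e \<in> edges G. uses xy e}. w e)"
  proof (rule sum_mono, clarify)
    fix x y assume xy: "(x, y) \<in> D"
    with P have path: "apath x (P x y) y" by auto
    then have "set (P x y) \<subseteq> parcs G"
      by (auto simp: apath_def)
    then have "(\<lambda>(u, v). {u, v}) ` set (P x y) = {e \<in> edges G. uses (x, y) e}"
      by (auto simp: edges_def uses_def)
    then show "d x y \<le> (\<Sum>e \<in> {e \<in> edges G. uses (x, y) e}. w e)"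
      using d[OF path] xy by (auto simp: D_def distinct_pairs_def)
  qed
  also have "\<dots> = (\<Sum>e \<in> edges G. \<Sum>xy \<in> {xy \<in> D. uses xy e}. w e)"
    by (rule sum.swap_restrict[OF fin finite_edges])
  also have "\<dots> = (\<Sum>e \<in> edges G. real (edge_load R e) * w e)"
  proof (rule sum.cong[OF refl])
    fix e
    have "edge_load R e = card {xy \<in> D. uses xy e}"
      unfolding edge_load_def R_eq uses_def
      by (rule card_filter_image) (use inj_on_paths P in \<open>auto simp: D_def\<close>)
    then show "(\<Sum>xy \<in> {xy \<in> D. uses xy e}. w e) = real (edge_load R e) * w e"
      by simp
  qed
  \<comment> \<open>After the exchange of summation each weight is multiplied by the load of its
    edge; nonnegative weights allow every load to be replaced by the maximum.\<close>
  also have "\<dots> \<le> (\<Sum>e \<in> edges G. real (max_edge_load G R) * w e)"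
    by (intro sum_mono mult_right_mono w)
       (auto simp: max_edge_load_def finite_edges intro!: Max_ge)
  finally show ?thesis
    by (simp add: D_def sum_distrib_left)
qed

section \<open>Walks and weights in circulant graphs\<close>

text \<open>The bound \<open>2 * s < n\<close> makes the steps 1, -1, s, -s pairwise incongruent mod
  \<open>n\<close>, so every arc has a unique type.\<close>

locale circulant =
  fixes n s :: int
  assumes s_gt_1: "1 < s" and s_lt: "2 * s < n"

sublocale circulant \<subseteq> pair_graph "circulant2 n s"
  using s_gt_1 s_lt by (intro pair_graph_circulant2) auto

context circulant
begin

lemma n_ge_5: "5 \<le> n"
  using s_gt_1 s_lt by linarith

lemma pverts_circulant2: "pverts (circulant2 n s) = {0..<n}"
  by (simp add: circulant2_def)

lemma parcs_circulant2_iff: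
  "(u, v) \<in> parcs (circulant2 n s) \<longleftrightarrow>
     u \<in> {0..<n} \<and> v \<in> {0..<n} \<and> (\<exists>d \<in> {1, -1, s, -s}. [v = u + d] (mod n))"
proof -
  have "[u - v = d] (mod n) \<longleftrightarrow> [v = u + - d] (mod n)" for d
  proof -
    have "v - (u + - d) = - (u - v - d)"
      by simp
    then show ?thesis
      unfolding cong_iff_dvd_diff by (metis dvd_minus_iff)
  qed
  then show ?thesis
    unfolding circulant2_def by auto
qed

lemma cong_imp_eq_vertex: "[u = v] (mod n) \<Longrightarrow> u \<in> {0..<n} \<Longrightarrow> v \<in> {0..<n} \<Longrightarrow> u = v"
  by (auto simp: cong_def)

lemma diff_mod_range:
  assumes "x \<in> {0..<n}" "y \<in> {0..<n}" "x \<noteq> y"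
  shows "(y - x) mod n \<in> {1..<n}"
proof -
  have "(y - x) mod n \<noteq> 0"
    using assms by (metis cong_def cong_diff_iff_cong_0 cong_imp_eq_vertex mod_0)
  then show ?thesis
    using n_ge_5 pos_mod_bound[of n "y - x"] pos_mod_sign[of n "y - x"]
    by (simp del: pos_mod_bound pos_mod_sign)
qed

lemma parcs_nonempty: "parcs (circulant2 n s) \<noteq> {}"
proof -
  have "(0, 1) \<in> parcs (circulant2 n s)"
    using n_ge_5 by (auto simp: parcs_circulant2_iff)
  then show ?thesis by blast
qed

section \<open>Walks given by step lists, and the loads of translation-invariant routings\<close>

primrec step_walk :: "int \<Rightarrow> int list \<Rightarrow> (int \<times> int) list" where
  "step_walk x [] = []"
| "step_walk x (d # ds) = (x, (x + d) mod n) # step_walk ((x + d) mod n) ds"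

lemma awalk_step_walk:
  assumes "set ds \<subseteq> {1, -1, s, -s}" "x \<in> {0..<n}"
  shows "awalk x (step_walk x ds) ((x + sum_list ds) mod n)"
  using assms
proof (induction ds arbitrary: x)
  case Nil
  then show ?case
    by (simp add: awalk_Nil_iff pverts_circulant2)
next
  case (Cons d ds)
  have "(x + d) mod n \<in> {0..<n}"
    using n_ge_5 by simp
  moreover from this have "(x, (x + d) mod n) \<in> parcs (circulant2 n s)"
    using Cons.prems by (auto simp: parcs_circulant2_iff cong_def)
  ultimately show ?case
    using Cons.IH[of "(x + d) mod n"] Cons.prems
    by (simp add: awalk_Cons_iff mod_add_left_eq add.assoc)
qed

text \<open>The start of a walk is determined by the vertex it has reached at a given position of
  \<open>ds\<close>. So each position accounts for at most one start, and for none unless its step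
  leads from \<open>u\<close> to \<open>v\<close>.\<close>

lemma card_step_walk_starts:
  "card {x \<in> {0..<n}. (u, v) \<in> set (step_walk x ds)} \<le>
     length (filter (\<lambda>d. [v = u + d] (mod n)) ds)"
proof (induction ds)
  case (Cons d ds)
  let ?S = "{x \<in> {0..<n}. (u, v) \<in> set (step_walk x ds)}"
  let ?f = "\<lambda>x. (x + d) mod n"
  \<comment> \<open>\<open>?T\<close> collects the starts whose remaining walk uses the arc,
    \<open>?U\<close> the start whose first step is the arc.\<close>
  let ?T = "{x \<in> {0..<n}. ?f x \<in> ?S}"
  let ?U = "{x. x = u \<and> v = (u + d) mod n}"
  have "{x \<in> {0..<n}. (u, v) \<in> set (step_walk x (d # ds))} \<subseteq> ?T \<union> ?U"
    using n_ge_5 by auto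
  then have "card {x \<in> {0..<n}. (u, v) \<in> set (step_walk x (d # ds))} \<le> card (?T \<union> ?U)"
    by (rule card_mono[rotated]) (auto intro: finite_subset[of _ "{0..<n}"])
  also have "\<dots> \<le> card ?T + card ?U"
    by (rule card_Un_le)
  also have "card ?T \<le> card ?S"
  proof (rule card_inj_on_le)
    show "inj_on ?f ?T"
      by (rule inj_onI, rule cong_imp_eq_vertex)
         (auto simp: cong_def[symmetric] simp del: cong_def intro: cong_add_rcancel[THEN iffD1])
  qed (auto intro: finite_subset[of _ "{0..<n}"])
  also have "?U = (if v = (u + d) mod n then {u} else {})"
    by auto
  also have "card \<dots> \<le> (if [v = u + d] (mod n) then 1 else 0)"
    by (auto simp: cong_def)
  finally show ?case
    using Cons.IH by (auto split: if_splits)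
qed simp

definition displacement :: "int \<Rightarrow> int \<Rightarrow> int list" where
  "displacement a b = replicate (nat \<bar>b\<bar>) (sgn b * s) @ replicate (nat \<bar>a\<bar>) (sgn a)"

lemma set_displacement: "set (displacement a b) \<subseteq> {1, -1, s, -s}"
  by (auto simp: displacement_def sgn_if)

lemma sum_list_displacement: "sum_list (displacement a b) = a + b * s"
  by (auto simp: displacement_def sum_list_replicate sgn_if abs_if algebra_simps)

text \<open>
  A translation-invariant routing that sends \<open>x\<close> to \<open>x + z\<close> by \<open>\<bar>b z\<bar>\<close> steps \<open>\<plusminus>s\<close> and
  \<open>\<bar>a z\<bar>\<close> steps \<open>\<plusminus>1\<close> loads all arcs of the same direction equally.
\<close>

lemma routing_of_displacements:
  fixes a b :: "int \<Rightarrow> int"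
  assumes ab: "\<And>z. z \<in> {1..<n} \<Longrightarrow> [a z + b z * s = z] (mod n)"
    and bounds: "(\<Sum>z = 1..<n. max 0 (a z)) \<le> L" "(\<Sum>z = 1..<n. max 0 (- a z)) \<le> L"
      "(\<Sum>z = 1..<n. max 0 (b z)) \<le> L" "(\<Sum>z = 1..<n. max 0 (- b z)) \<le> L"
  obtains R where "all_to_all_routing (circulant2 n s) R"
    and "int (max_arc_load (circulant2 n s) R) \<le> L"
proof -
  define ds where "ds z = displacement (a z) (b z)" for z
  define W where "W x y = step_walk x (ds ((y - x) mod n))" for x y
  have "awalk x (W x y) y" if "(x, y) \<in> distinct_pairs (pverts (circulant2 n s))" for x y
  proof -
    from that have xy: "x \<in> {0..<n}" "y \<in> {0..<n}" "x \<noteq> y"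
      by (auto simp: distinct_pairs_def pverts_circulant2)
    from ab[OF diff_mod_range[OF xy]] have "[x + sum_list (ds ((y - x) mod n)) = x + (y - x) mod n] (mod n)"
      by (simp add: ds_def sum_list_displacement cong_add_lcancel)
    also have "[x + (y - x) mod n = y] (mod n)"
      by (simp add: cong_def mod_add_right_eq)
    finally have "(x + sum_list (ds ((y - x) mod n))) mod n = y"
      using xy by (simp add: cong_def)
    then show ?thesis
      using awalk_step_walk[of "ds ((y - x) mod n)" x] xy(1) set_displacement
      by (simp add: W_def ds_def)
  qed
  then obtain R where R: "all_to_all_routing (circulant2 n s) R"
    and load: "\<And>e. arc_load R e \<le>
      card {(x, y) \<in> distinct_pairs (pverts (circulant2 n s)). e \<in> set (W x y)}"
    using routing_of_walks by blast
  have le: "int (arc_load R (u, v)) \<le>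
      (\<Sum>z = 1..<n. int (length (filter (\<lambda>d. [v = u + d] (mod n)) (ds z))))" for u v
  proof -
    let ?X = "\<lambda>z. {x \<in> {0..<n}. (u, v) \<in> set (step_walk x (ds z))}"
    \<comment> \<open>Pairs \<open>(x, y)\<close> are regrouped by their difference
      \<open>z\<close>: all pairs with the same \<open>z\<close> follow translates of one
      walk.\<close>
    have "arc_load R (u, v) \<le> card (SIGMA z:{1..<n}. ?X z)"
    proof (rule order.trans[OF load card_inj_on_le])
      let ?f = "\<lambda>(x, y). ((y - x) mod n, x)"
      show "inj_on ?f {(x, y) \<in> distinct_pairs (pverts (circulant2 n s)). (u, v) \<in> set (W x y)}"
      proof (rule inj_onI)
        fix p p'
        assume p: "p \<in> {(x, y) \<in> distinct_pairs (pverts (circulant2 n s)). (u, v) \<in> set (W x y)}"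
          "p' \<in> {(x, y) \<in> distinct_pairs (pverts (circulant2 n s)). (u, v) \<in> set (W x y)}"
          and eq: "?f p = ?f p'"
        then obtain x y y' where xy: "p = (x, y)" "p' = (x, y')"
          and V: "y \<in> {0..<n}" "y' \<in> {0..<n}"
          by (auto simp: distinct_pairs_def pverts_circulant2)
        with eq have "[y - x = y' - x] (mod n)"
          by (simp add: cong_def)
        then have "[y = y'] (mod n)"
          using cong_add[of "y - x" "y' - x" n x x] by simp
        then show "p = p'"
          using cong_imp_eq_vertex V xy by simp
      qed
      show "?f ` {(x, y) \<in> distinct_pairs (pverts (circulant2 n s)). (u, v) \<in> set (W x y)}
          \<subseteq> (SIGMA z:{1..<n}. ?X z)"
      proof (rule image_subsetI)
        fix xy assume "xy \<in> {(x, y) \<in> distinct_pairs (pverts (circulant2 n s)). (u, v) \<in> set (W x y)}"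
        then obtain x y where eq: "xy = (x, y)"
          and *: "(x, y) \<in> distinct_pairs (pverts (circulant2 n s))" "(u, v) \<in> set (W x y)"
          by auto
        then have xy: "x \<in> {0..<n}" "y \<in> {0..<n}" "x \<noteq> y"
          by (auto simp: distinct_pairs_def pverts_circulant2)
        with * diff_mod_range[OF xy] show "?f xy \<in> (SIGMA z:{1..<n}. ?X z)"
          by (simp add: W_def eq)
      qed
    qed (auto intro!: finite_SigmaI intro: finite_subset[of _ "{0..<n}"])
    also have "\<dots> = (\<Sum>z = 1..<n. card (?X z))"
      by (rule card_SigmaI) (auto intro: finite_subset[of _ "{0..<n}"])
    also have "\<dots> \<le> (\<Sum>z = 1..<n. length (filter (\<lambda>d. [v = u + d] (mod n)) (ds z)))"
      by (intro sum_mono card_step_walk_starts)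
    finally show ?thesis
      by (metis (mono_tags, lifting) int_sum of_nat_mono sum.cong)
  qed
  have "int (arc_load R e) \<le> L" if "e \<in> parcs (circulant2 n s)" for e
  proof (cases e)
    case (Pair u v)
    with that obtain d where d: "d \<in> {1, -1, s, -s}" "[v = u + d] (mod n)"
      unfolding Pair parcs_circulant2_iff by blast
    \<comment> \<open>Two of the four steps differ by less than \<open>n\<close> in absolute value,
      so congruent steps are equal. Hence the load of the arc involves only one of the four sums in
      \<open>bounds\<close>.\<close>
    have iff: "[v = u + d'] (mod n) \<longleftrightarrow> d' = d" if "d' \<in> {1, -1, s, -s}" for d'
    proof
      assume "[v = u + d'] (mod n)"
      with d have "[d' = d] (mod n)"
        by (metis cong_add_lcancel cong_sym cong_trans)
      then have "n dvd d' - d"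
        by (simp add: cong_iff_dvd_diff)
      moreover have "\<bar>d' - d\<bar> < n"
        using that d(1) s_gt_1 s_lt by auto
      ultimately show "d' = d"
        by (metis dvd_imp_le_int eq_iff_diff_eq_0 abs_of_pos linorder_not_le n_ge_5
            order_less_le_trans zero_less_numeral)
    qed (use d in simp)
    have "filter (\<lambda>d'. [v = u + d'] (mod n)) (ds z) = filter (\<lambda>d'. d' = d) (ds z)" for z
      using set_displacement[of "a z" "b z"] by (intro filter_cong refl iff) (auto simp: ds_def)
    then have "int (arc_load R e) \<le> (\<Sum>z = 1..<n. int (length (filter (\<lambda>d'. d' = d) (ds z))))"
      using le[of u v] Pair by simp
    also have "\<dots> \<le> L"
    proof -
      have "int (length (filter (\<lambda>d'. d' = d) (ds z))) =
          (if d = 1 then max 0 (a z) else if d = -1 then max 0 (- a z)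
           else if d = s then max 0 (b z) else max 0 (- b z))" for z
        using d(1) s_gt_1 by (auto simp: ds_def displacement_def sgn_if)
      then show ?thesis
        using bounds by (cases "d = 1"; cases "d = -1"; cases "d = s") simp_all
    qed
    finally show ?thesis .
  qed
  moreover have "max_arc_load (circulant2 n s) R \<in> arc_load R ` parcs (circulant2 n s)"
    unfolding max_arc_load_def by (rule Max_in) (use parcs_nonempty pair_finite_arcs in auto)
  ultimately have "int (max_arc_load (circulant2 n s) R) \<le> L"
    by auto
  with R show ?thesis
    by (rule that)
qed

text \<open>A path of the graph lifts to a walk in the square lattice of displacements \<open>(a, b)\<close>.\<close>

definition near_edges :: "int set set" where
  "near_edges = (\<lambda>x. {x, (x + 1) mod n}) ` {0..<n}"

lemma path_displacement:
  fixes w1 ws :: real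
  assumes "apath x p y" and w: "0 \<le> w1" "0 \<le> ws"
  shows "\<exists>a b. [a + b * s = y - x] (mod n) \<and>
    w1 * \<bar>real_of_int a\<bar> + ws * \<bar>real_of_int b\<bar> \<le>
      (\<Sum>e \<in> (\<lambda>(u, v). {u, v}) ` set p. if e \<in> near_edges then w1 else ws)"
  using assms(1)
proof (induction p arbitrary: x)
  case Nil
  then show ?case
    by (intro exI[of _ 0]) (auto simp: apath_Nil_iff)
next
  case (Cons e p)
  obtain u v where e: "e = (u, v)" by (cases e)
  from Cons.prems e have x: "x = u" and uv: "(u, v) \<in> parcs (circulant2 n s)"
    and path: "apath v p y" and new: "u \<notin> set (pawalk_verts v p)"
    by (auto simp: apath_Cons_iff)
  let ?E = "(\<lambda>(u, v). {u, v}) ` set p"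
  let ?w = "\<lambda>e. if e \<in> near_edges then w1 else ws"
  from Cons.IH[OF path] obtain a b where ab: "[a + b * s = y - v] (mod n)"
    "w1 * \<bar>real_of_int a\<bar> + ws * \<bar>real_of_int b\<bar> \<le> sum ?w ?E"
    by blast
  \<comment> \<open>The vertices of a path are distinct, so its first edge never recurs, and the sum
    over the set of edges is a sum along the path.\<close>
  have "{u, v} \<notin> ?E"
    using new awalk_verts_arc1[of _ p v] awalk_verts_arc2[OF awalkI_apath[OF path]]
    by (force simp: doubleton_eq_iff)
  then have sum: "sum ?w ((\<lambda>(u, v). {u, v}) ` set (e # p)) = ?w {u, v} + sum ?w ?E"
    by (simp add: e)
  \<comment> \<open>One arc moves the lattice point by a unit vector: (1,0) or (-1,0) for a near
    edge, (0,1) or (0,-1) otherwise. The triangle inequality then adds the weights up.\<close>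
  obtain da db :: int where step: "[v - u = da + db * s] (mod n)"
    and le: "w1 * \<bar>real_of_int da\<bar> + ws * \<bar>real_of_int db\<bar> \<le> ?w {u, v}"
  proof (cases "{u, v} \<in> near_edges")
    case True
    then obtain t where "{u, v} = {t, (t + 1) mod n}"
      by (auto simp: near_edges_def)
    then have "[v - u = 1] (mod n) \<or> [v - u = -1] (mod n)"
      by (auto simp: doubleton_eq_iff cong_def mod_diff_left_eq mod_diff_right_eq)
    then show ?thesis
      using that[of 1 0] that[of "-1" 0] True by auto
  next
    case False
    from uv obtain d where d: "d \<in> {1, -1, s, -s}" "[v = u + d] (mod n)"
      and V: "u \<in> {0..<n}" "v \<in> {0..<n}"
      unfolding parcs_circulant2_iff by blast
    have "d \<noteq> 1"
    proof
      assume "d = 1"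
      then have "v = (u + 1) mod n" using d V by (simp add: cong_def)
      with False V show False by (auto simp: near_edges_def)
    qed
    moreover have "d \<noteq> -1"
    proof
      assume "d = -1"
      then have "u = (v + 1) mod n" using d V by (simp add: cong_def mod_add_left_eq)
      with False V show False by (auto simp: near_edges_def insert_commute)
    qed
    moreover have "[v - u = d] (mod n)"
      using cong_diff[OF d(2) cong_refl[of u]] by simp
    ultimately show ?thesis
      using that[of 0 1] that[of 0 "-1"] d(1) False by auto
  qed
  have "[(a + da) + (b + db) * s = y - x] (mod n)"
    using cong_add[OF ab(1) cong_sym[OF step]] x by (simp add: algebra_simps)
  moreover have "w1 * \<bar>real_of_int (a + da)\<bar> + ws * \<bar>real_of_int (b + db)\<bar> \<le>
      ?w {u, v} + sum ?w ?E"
  proof -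
    have "w1 * \<bar>real_of_int (a + da)\<bar> \<le> w1 * (\<bar>real_of_int a\<bar> + \<bar>real_of_int da\<bar>)"
      by (rule mult_left_mono) (use w in auto)
    moreover have "ws * \<bar>real_of_int (b + db)\<bar> \<le> ws * (\<bar>real_of_int b\<bar> + \<bar>real_of_int db\<bar>)"
      by (rule mult_left_mono) (use w in auto)
    ultimately show ?thesis
      using ab(2) le by (simp add: algebra_simps)
  qed
  ultimately show ?case
    unfolding sum by blast
qed

section \<open>Edge counts by type and the weighted lower-bound inequality\<close>

lemma sum_edge_weights_le:
  fixes w1 ws :: real
  assumes w: "0 \<le> w1" "0 \<le> ws"
  shows "(\<Sum>e \<in> edges (circulant2 n s). if e \<in> near_edges then w1 else ws) \<le> n * (w1 + ws)"
proof -
  define far_edges where "far_edges = (\<lambda>x. {x, (x + s) mod n}) ` {0..<n}"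
  have fin: "finite near_edges" "finite far_edges"
    by (auto simp: near_edges_def far_edges_def)
  have card: "card near_edges \<le> nat n" "card far_edges \<le> nat n"
    unfolding near_edges_def far_edges_def
    using card_image_le[of "{0..<n}" "\<lambda>x. {x, (x + 1) mod n}"]
      card_image_le[of "{0..<n}" "\<lambda>x. {x, (x + s) mod n}"] by auto
  have "edges (circulant2 n s) \<subseteq> near_edges \<union> far_edges"
  proof
    fix e assume "e \<in> edges (circulant2 n s)"
    then obtain u v where e: "e = {u, v}" and uv: "(u, v) \<in> parcs (circulant2 n s)"
      by (auto simp: edges_def)
    from uv obtain d where d: "d \<in> {1, -1, s, -s}" "[v = u + d] (mod n)"
      and V: "u \<in> {0..<n}" "v \<in> {0..<n}"
      unfolding parcs_circulant2_iff by blast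
    have fwd: "v = (u + d) mod n"
      using d V by (simp add: cong_def)
    have "[v + - d = u] (mod n)"
      using cong_add[OF d(2) cong_refl[of "- d"]] by simp
    then have bwd: "u = (v + - d) mod n"
      using V by (simp add: cong_def)
    from d(1) consider "d = 1 \<or> d = s" | "- d = 1 \<or> - d = s"
      by auto
    then show "e \<in> near_edges \<union> far_edges"
    proof cases
      case 1
      then have "v = (u + 1) mod n \<or> v = (u + s) mod n"
        using fwd by auto
      then show ?thesis
        using V(1) unfolding e near_edges_def far_edges_def by blast
    next
      case 2
      then have "u = (v + 1) mod n \<or> u = (v + s) mod n"
        using bwd by auto
      moreover have "e = {v, u}"
        by (simp add: e insert_commute)
      ultimately show ?thesis
        using V(2) unfolding near_edges_def far_edges_def by blast
    qed
  qed
  then have "(\<Sum>e \<in> edges (circulant2 n s). if e \<in> near_edges then w1 else ws) \<le>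
      (\<Sum>e \<in> near_edges \<union> far_edges. if e \<in> near_edges then w1 else ws)"
    by (intro sum_mono2) (use w fin in auto)
  also have "\<dots> \<le> (\<Sum>e \<in> near_edges. w1) + (\<Sum>e \<in> far_edges. ws)"
  proof -
    \<comment> \<open>Removing the near edges from the far ones makes the union disjoint; each
      family has at most \<open>n\<close> members, one for each starting residue.\<close>
    have "(\<Sum>e \<in> near_edges \<union> far_edges. if e \<in> near_edges then w1 else ws) =
        (\<Sum>e \<in> near_edges. w1) + (\<Sum>e \<in> far_edges - near_edges. ws)"
    proof -
      have "(\<Sum>e \<in> near_edges \<union> (far_edges - near_edges). if e \<in> near_edges then w1 else ws) =
          (\<Sum>e \<in> near_edges. if e \<in> near_edges then w1 else ws) +
          (\<Sum>e \<in> far_edges - near_edges. if e \<in> near_edges then w1 else ws)"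
        by (rule sum.union_disjoint) (use fin in auto)
      then show ?thesis
        by simp
    qed
    also have "(\<Sum>e \<in> far_edges - near_edges. ws) \<le> (\<Sum>e \<in> far_edges. ws)"
      by (rule sum_mono2) (use w fin in auto)
    finally show ?thesis by simp
  qed
  also have "\<dots> \<le> n * w1 + n * ws"
  proof -
    have "real (card near_edges) \<le> n" "real (card far_edges) \<le> n"
      using card n_ge_5 by linarith+
    then show ?thesis
      using w by (simp add: add_mono mult_right_mono)
  qed
  finally show ?thesis
    by (simp add: algebra_simps)
qed

lemma sum_distinct_pairs:
  fixes d :: "int \<Rightarrow> real"
  shows "(\<Sum>(x, y) \<in> distinct_pairs {0..<n}. d ((y - x) mod n)) = n * (\<Sum>z = 1..<n. d z)"
proof -
  have "(\<Sum>(x, y) \<in> distinct_pairs {0..<n}. d ((y - x) mod n)) =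
      (\<Sum>(x, z) \<in> {0..<n} \<times> {1..<n}. d z)"
  proof (rule sum.reindex_bij_witness[where i = "\<lambda>(x, z). (x, (x + z) mod n)"
        and j = "\<lambda>(x, y). (x, (y - x) mod n)"], goal_cases)
    case (1 xy)
    then show ?case
      by (auto simp: distinct_pairs_def mod_add_right_eq)
  next
    case (2 xy)
    then obtain x y where xy: "xy = (x, y)" "x \<in> {0..<n}" "y \<in> {0..<n}" "x \<noteq> y"
      by (auto simp: distinct_pairs_def)
    then show ?case
      using diff_mod_range[OF xy(2-4)] by auto
  next
    case (3 xz)
    then show ?case
      by (auto simp: mod_diff_left_eq)
  next
    case (4 xz)
    then obtain x z where xz: "xz = (x, z)" "x \<in> {0..<n}" "z \<in> {1..<n}"
      by auto
    have "x \<noteq> (x + z) mod n"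
    proof
      assume "x = (x + z) mod n"
      then have "[x + z = x + 0] (mod n)" using xz by (simp add: cong_def)
      then have "[z = 0] (mod n)" by (simp only: cong_add_lcancel)
      with xz show False by (auto simp: cong_def)
    qed
    then show ?case
      using xz n_ge_5 by (auto simp: distinct_pairs_def)
  next
    case (5 xy)
    then show ?case by (cases xy) auto
  qed
  also have "\<dots> = (\<Sum>x \<in> {0..<n}. \<Sum>z = 1..<n. d z)"
    by (rule sum.cartesian_product[symmetric])
  finally show ?thesis
    using n_ge_5 by simp
qed

text \<open>Double counting over all pairs, with \<open>d\<close> a lower bound on path weights.
  Each difference \<open>z\<close> occurs for \<open>n\<close> pairs and each edge type has at most
  \<open>n\<close> edges, so the factor \<open>n\<close> cancels.\<close>

lemma displacement_weight_le_load:
  fixes w1 ws :: real and d :: "int \<Rightarrow> real"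
  assumes R: "all_to_all_routing (circulant2 n s) R"
    and w: "0 \<le> w1" "0 \<le> ws"
    and d: "\<And>z a b. z \<in> {1..<n} \<Longrightarrow> [a + b * s = z] (mod n) \<Longrightarrow>
      d z \<le> w1 * \<bar>real_of_int a\<bar> + ws * \<bar>real_of_int b\<bar>"
  shows "(\<Sum>z = 1..<n. d z) \<le> max_edge_load (circulant2 n s) R * (w1 + ws)"
proof -
  have "n * (\<Sum>z = 1..<n. d z) \<le> max_edge_load (circulant2 n s) R *
      (\<Sum>e \<in> edges (circulant2 n s). if e \<in> near_edges then w1 else ws)"
    unfolding sum_distinct_pairs[symmetric] pverts_circulant2[symmetric]
  proof (rule sum_path_weights_le[OF R])
    fix x p y assume path: "apath x p y" and "x \<noteq> y"
    have xy: "x \<in> {0..<n}" "y \<in> {0..<n}"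
      using path awalk_hd_in_verts awalk_last_in_verts
      by (auto simp: apath_def pverts_circulant2[symmetric])
    have z: "(y - x) mod n \<in> {1..<n}"
      using xy \<open>x \<noteq> y\<close> by (rule diff_mod_range)
    obtain a b where ab: "[a + b * s = y - x] (mod n)"
      "w1 * \<bar>real_of_int a\<bar> + ws * \<bar>real_of_int b\<bar> \<le>
        (\<Sum>e \<in> (\<lambda>(u, v). {u, v}) ` set p. if e \<in> near_edges then w1 else ws)"
      using path_displacement[OF path w] by blast
    from ab(1) have "[a + b * s = (y - x) mod n] (mod n)"
      by (simp add: cong_def)
    from d[OF z this] ab(2) show "d ((y - x) mod n) \<le>
        (\<Sum>e \<in> (\<lambda>(u, v). {u, v}) ` set p. if e \<in> near_edges then w1 else ws)"
      by linarith
  qed (use w in auto)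
  also have "\<dots> \<le> max_edge_load (circulant2 n s) R * (n * (w1 + ws))"
    by (intro mult_left_mono sum_edge_weights_le w) auto
  finally have "n * (\<Sum>z = 1..<n. d z) \<le> n * (max_edge_load (circulant2 n s) R * (w1 + ws))"
    by (simp add: algebra_simps)
  then show ?thesis
    using n_ge_5 by (simp add: mult_le_cancel_left_pos)
qed

end

section \<open>Division with least absolute remainder\<close>

lemma sum_atLeastAtMost_plus1_int:
  fixes f :: "int \<Rightarrow> 'b::comm_monoid_add"
  assumes "0 \<le> h"
  shows "(\<Sum>z = 1..h + 1. f z) = (\<Sum>z = 1..h. f z) + f (h + 1)"
proof -
  have "{1..h + 1} = insert (h + 1) {1..h}"
    using assms by auto
  then show ?thesis
    by (simp add: add.commute)
qed

context circulant
begin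

text \<open>
  Division by \<open>s\<close> with the remainder of least absolute value; for even \<open>s\<close> the tie
  \<open>\<plusminus>s/2\<close> goes to the smaller quotient.
\<close>

definition nearest_quot :: "int \<Rightarrow> int" where
  "nearest_quot z = (z + (s - 1) div 2) div s"

definition nearest_rem :: "int \<Rightarrow> int" where
  "nearest_rem z = z - s * nearest_quot z"

lemma nearest_rem_bounds: "- ((s - 1) div 2) \<le> nearest_rem z" "nearest_rem z \<le> s div 2"
proof -
  have "nearest_rem z = (z + (s - 1) div 2) mod s - (s - 1) div 2"
    by (simp add: nearest_rem_def nearest_quot_def minus_mult_div_eq_mod [symmetric])
  moreover have "0 \<le> (z + (s - 1) div 2) mod s" "(z + (s - 1) div 2) mod s < s"
    using s_gt_1 by auto
  ultimately show "- ((s - 1) div 2) \<le> nearest_rem z" "nearest_rem z \<le> s div 2"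
    by linarith+
qed

lemma nearest_quot_rem: "s * nearest_quot z + nearest_rem z = z"
  by (simp add: nearest_rem_def)

lemma nearest_unique:
  assumes "- ((s - 1) div 2) \<le> a" "a \<le> s div 2"
  shows "nearest_quot (s * b + a) = b" "nearest_rem (s * b + a) = a"
proof -
  have "(s * b + a + (s - 1) div 2) div s = b"
    by (rule int_div_pos_eq[of _ _ _ "a + (s - 1) div 2"]) (use assms s_gt_1 in linarith)+
  then show "nearest_quot (s * b + a) = b"
    by (simp add: nearest_quot_def)
  then show "nearest_rem (s * b + a) = a"
    by (simp add: nearest_rem_def)
qed

lemma nearest_0: "nearest_quot 0 = 0" "nearest_rem 0 = 0"
  using nearest_unique[of 0 0] s_gt_1 by auto

lemma nearest_quot_nonneg: "0 \<le> z \<Longrightarrow> 0 \<le> nearest_quot z"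
  using s_gt_1 by (simp add: nearest_quot_def pos_imp_zdiv_nonneg_iff)

text \<open>The remainder climbs through its window of \<open>s\<close> values and wraps from the
  top to the bottom while the quotient advances. This drives the inductions for both closed forms
  below.\<close>

lemma nearest_step:
  "nearest_rem z < s div 2 \<and> nearest_quot (z + 1) = nearest_quot z \<and> nearest_rem (z + 1) = nearest_rem z + 1
   \<or> nearest_rem z = s div 2 \<and> nearest_quot (z + 1) = nearest_quot z + 1
     \<and> nearest_rem (z + 1) = - ((s - 1) div 2)"
proof (cases "nearest_rem z < s div 2")
  case True
  then show ?thesis
    using nearest_unique[of "nearest_rem z + 1" "nearest_quot z"] nearest_rem_bounds[of z]
      nearest_quot_rem[of z] by (simp add: add.assoc[symmetric])
next
  case False
  then have eq: "nearest_rem z = s div 2"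
    using nearest_rem_bounds[of z] by simp
  have "s * (nearest_quot z + 1) + - ((s - 1) div 2) = z + 1"
    using nearest_quot_rem[of z] eq by (simp add: distrib_left)
  then show ?thesis
    using nearest_unique[of "- ((s - 1) div 2)" "nearest_quot z + 1"] s_gt_1 eq
    by (metis (no_types, lifting) add_increasing2 div_pos_pos_trivial dual_order.trans
        neg_le_0_iff_le order_refl pos_imp_zdiv_nonneg_iff zero_less_numeral zle_diff1_eq
        int_one_le_iff_zero_less less_imp_le linorder_not_less nearest_rem_bounds)
qed

text \<open>With \<open>k\<close> and \<open>t\<close> the quotient and remainder of
  \<open>h\<close>: each quotient strictly between 0 and \<open>k\<close> is taken \<open>s\<close>
  times, and a positive \<open>k\<close> is taken \<open>t + (s - 1) div 2 + 1\<close> times up to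
  \<open>h\<close>.\<close>

lemma sum_nearest_quot:
  assumes "0 \<le> h"
  shows "2 * (\<Sum>z = 1..h. nearest_quot z) =
    s * nearest_quot h * (nearest_quot h - 1)
    + 2 * nearest_quot h * (nearest_rem h + (s - 1) div 2 + 1)"
  using assms
proof (induction h rule: int_ge_induct)
  case base
  then show ?case by (simp add: nearest_0)
next
  case (step h)
  have "s div 2 + (s - 1) div 2 + 1 = s"
    by linarith
  then show ?case
    using nearest_step[of h] step.IH
    unfolding sum_atLeastAtMost_plus1_int[OF step.hyps]
    by (elim disjE) (auto simp: algebra_simps)
qed

text \<open>Over a full period the absolute remainders sum to \<open>(s^2 - s mod 2) / 4\<close>.
  The last term corrects from \<open>s * k\<close> to \<open>h\<close>, where \<open>k\<close> and
  \<open>t\<close> are the quotient and remainder of \<open>h\<close>: for \<open>t \<ge> 0\<close>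
  it adds 1, ..., t; for \<open>t < 0\<close> it removes the absolute values of the remainders -1,
  ..., t + 1 beyond \<open>h\<close>.\<close>

lemma sum_abs_nearest_rem:
  assumes "0 \<le> h"
  shows "8 * (\<Sum>z = 1..h. \<bar>nearest_rem z\<bar>) =
    2 * nearest_quot h * (s\<^sup>2 - s mod 2) + 4 * \<bar>nearest_rem h\<bar> * (nearest_rem h + 1)"
  using assms
proof (induction h rule: int_ge_induct)
  case base
  then show ?case by (simp add: nearest_0)
next
  case (step h)
  let ?k = "nearest_quot h"
  consider "nearest_rem h < s div 2" "nearest_quot (h + 1) = ?k" "nearest_rem (h + 1) = nearest_rem h + 1"
    | "nearest_rem h = s div 2" "nearest_quot (h + 1) = ?k + 1"
      "nearest_rem (h + 1) = - ((s - 1) div 2)"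
    using nearest_step[of h] by blast
  then show ?case
  proof cases
    case 1
    have "4 * \<bar>t\<bar> * (t + 1) + 8 * \<bar>t + 1\<bar> = 4 * \<bar>t + 1\<bar> * (t + 1 + 1)" for t :: int
      by (cases "t \<ge> 0"; cases "t = -1") (auto simp: algebra_simps)
    then show ?thesis
      using 1 step.IH by (simp add: sum_atLeastAtMost_plus1_int[OF step.hyps] distrib_left)
  next
    case 2
    \<comment> \<open>At the wrap the correction term changes sign and one full period is
      completed.\<close>
    have "4 * \<bar>s div 2\<bar> * (s div 2 + 1) + 8 * \<bar>- ((s - 1) div 2)\<bar> =
        2 * (s\<^sup>2 - s mod 2) + 4 * \<bar>- ((s - 1) div 2)\<bar> * (- ((s - 1) div 2) + 1)"
    proof (cases "even s")
      case True
      then obtain m where m: "s = 2 * m" by blast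
      then have eqs: "(s - 1) div 2 = m - 1" "s div 2 = m" "s mod 2 = 0" by auto
      show ?thesis unfolding eqs using m s_gt_1 by (simp add: power2_eq_square algebra_simps)
    next
      case False
      then obtain m where m: "s = 2 * m + 1" by (elim oddE)
      then have eqs: "(s - 1) div 2 = m" "s div 2 = m" "s mod 2 = 1" by auto
      show ?thesis unfolding eqs using m s_gt_1 by (simp add: power2_eq_square algebra_simps)
    qed
    then show ?thesis
      using 2 step.IH by (simp add: sum_atLeastAtMost_plus1_int[OF step.hyps] distrib_left distrib_right)
  qed
qed

section \<open>Closed forms and bounds for the two costs\<close>

definition near_cost :: int where
  "near_cost = (\<Sum>z = 1..n div 2. \<bar>nearest_rem z\<bar>)"

definition far_cost :: int where
  "far_cost = (\<Sum>z = 1..n div 2. nearest_quot z)"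

text \<open>Doubling the nearest division of \<open>n div 2\<close> gives
  \<open>n = s * (2 * k) + (2 * t + e)\<close>. The tentative remainder \<open>2 * t + e\<close> may
  be proper, negative (borrow one \<open>s\<close>), or at least \<open>s\<close> (carry one); the
  carry occurs only with \<open>t\<close> at the top of its window.\<close>

lemma half_quot_rem:
  fixes k t e :: int
  defines "k \<equiv> nearest_quot (n div 2)" and "t \<equiv> nearest_rem (n div 2)" and "e \<equiv> n mod 2"
  shows "n div s = 2 * k \<and> n mod s = 2 * t + e \<and> 0 \<le> t
    \<or> n div s = 2 * k - 1 \<and> n mod s = s + 2 * t + e \<and> t < 0
    \<or> n div s = 2 * k + 1 \<and> n mod s = e - s mod 2 \<and> 2 * t = s - s mod 2 \<and> s mod 2 \<le> e"
proof -
  have n: "n = s * (2 * k) + (2 * t + e)"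
  proof -
    have "s * k + t = n div 2"
      unfolding k_def t_def by (rule nearest_quot_rem)
    moreover have "n = 2 * (n div 2) + e"
      by (simp add: e_def)
    ultimately show ?thesis
      by (simp add: algebra_simps)
  qed
  have t: "- ((s - 1) div 2) \<le> t" "t \<le> s div 2"
    unfolding t_def by (rule nearest_rem_bounds)+
  have e: "0 \<le> e" "e \<le> 1"
    unfolding e_def by auto
  have div_mod: "n div s = q' \<and> n mod s = r'" if "n = s * q' + r'" "0 \<le> r'" "r' < s" for q' r'
    using that int_div_pos_eq[of n s q' r'] int_mod_pos_eq[of n s q' r'] by simp
  show ?thesis
  proof (cases "t < 0")
    case True
    have "n = s * (2 * k - 1) + (s + 2 * t + e)"
      using n by (simp add: algebra_simps)
    moreover have "0 \<le> s + 2 * t + e" "s + 2 * t + e < s"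
      using True t e by linarith+
    ultimately have "n div s = 2 * k - 1 \<and> n mod s = s + 2 * t + e"
      by (rule div_mod)
    with True show ?thesis
      by blast
  next
    case nonneg: False
    show ?thesis
    proof (cases "2 * t + e < s")
      case True
      with nonneg e have "n div s = 2 * k \<and> n mod s = 2 * t + e"
        by (intro div_mod n) auto
      with nonneg show ?thesis
        by simp
    next
      case False
      then have *: "2 * t = s - s mod 2" "s mod 2 \<le> e"
        using t e by presburger+
      then have "n = s * (2 * k + 1) + (e - s mod 2)"
        using n by (simp add: algebra_simps)
      moreover have "0 \<le> e - s mod 2" "e - s mod 2 < s"
        using * e s_gt_1 by presburger+
      ultimately have "n div s = 2 * k + 1 \<and> n mod s = e - s mod 2"
        by (rule div_mod)
      with * show ?thesis
        by simp
    qed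
  qed
qed

lemma costs_eq:
  fixes k t :: int
  defines "k \<equiv> nearest_quot (n div 2)" and "t \<equiv> nearest_rem (n div 2)"
  shows "8 * far_cost = 4 * s * k * k + 8 * k * t + 4 * k * (s mod 2)"
    and "8 * near_cost = 2 * k * (s\<^sup>2 - s mod 2) + 4 * \<bar>t\<bar> * (t + 1)"
proof -
  have "0 \<le> n div 2"
    using n_ge_5 by simp
  note sums = sum_nearest_quot[OF this] sum_abs_nearest_rem[OF this]
  have "2 * ((s - 1) div 2) = s + s mod 2 - 2"
    by presburger
  then have "8 * k * ((s - 1) div 2) = 4 * k * (s + s mod 2 - 2)"
    by (metis (no_types, lifting) mult.assoc mult.left_commute numeral_Bit0_eq_double)
  then show "8 * far_cost = 4 * s * k * k + 8 * k * t + 4 * k * (s mod 2)"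
    using sums(1) unfolding far_cost_def k_def t_def by (simp add: algebra_simps)
  show "8 * near_cost = 2 * k * (s\<^sup>2 - s mod 2) + 4 * \<bar>t\<bar> * (t + 1)"
    using sums(2) unfolding near_cost_def k_def t_def by simp
qed

text \<open>Since \<open>n - r = q * s\<close>, the right-hand side times \<open>s\<close> is
  \<open>(n - r) * (n + r + 2) + s^2\<close>, the numerator of the upper bound for small
  \<open>s\<close>.\<close>

lemma far_cost_le: "8 * far_cost \<le> s * (n div s)\<^sup>2 + 2 * (n div s) * (n mod s + 1) + s"
proof -
  define k t e where "k = nearest_quot (n div 2)" and "t = nearest_rem (n div 2)" and "e = n mod 2"
  define \<sigma> where "\<sigma> = s mod 2"
  have \<sigma>: "\<sigma> = 0 \<or> \<sigma> = 1" and e: "e = 0 \<or> e = 1"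
    unfolding \<sigma>_def e_def by presburger+
  have k: "0 \<le> k"
    using nearest_quot_nonneg n_ge_5 by (simp add: k_def)
  have r: "n mod s < s" and q: "0 < n div s"
    using s_gt_1 s_lt by (auto simp: pos_imp_zdiv_pos_iff)
  have far: "8 * far_cost = 4 * s * k * k + 8 * k * t + 4 * k * \<sigma>"
    unfolding k_def t_def \<sigma>_def by (rule costs_eq)
  show ?thesis
    using half_quot_rem[folded k_def t_def e_def \<sigma>_def]
  proof (elim disjE conjE)
    assume "n div s = 2 * k" "n mod s = 2 * t + e" "0 \<le> t"
    then show ?thesis
      using far \<sigma> e k s_gt_1 by (auto simp: power2_eq_square algebra_simps)
  next
    assume *: "n div s = 2 * k - 1" "n mod s = s + 2 * t + e" "t < 0"
    \<comment> \<open>Here the slack is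
      \<open>4 * k * (1 + e - \<sigma>) - 2 * (2 * t + e) - 2\<close>, nonnegative by these two
      signs.\<close>
    have "2 * t + e < 0" "0 < 2 * k - 1"
      using r q * by simp_all
    then show ?thesis
      unfolding * using far \<sigma> e s_gt_1 by (auto simp: power2_eq_square algebra_simps)
  next
    assume "n div s = 2 * k + 1" "n mod s = e - \<sigma>" "2 * t = s - \<sigma>" "\<sigma> \<le> e"
    moreover from this have "s = 2 * t + \<sigma>" by simp
    ultimately show ?thesis
      using far \<sigma> e k s_gt_1 by (auto simp: power2_eq_square algebra_simps)
  qed
qed

text \<open>The right-hand side times \<open>s\<close> is
  \<open>s^2 * (n + r + 2) - (s mod 2) * (n - r)\<close>, the numerator of the upper bound for large
  \<open>s\<close>.\<close>

lemma near_cost_le: "8 * near_cost \<le> (n div s) * (s\<^sup>2 - s mod 2) + 2 * s * (n mod s + 1)"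
proof -
  define k t e where "k = nearest_quot (n div 2)" and "t = nearest_rem (n div 2)" and "e = n mod 2"
  define \<sigma> where "\<sigma> = s mod 2"
  have \<sigma>: "\<sigma> = 0 \<or> \<sigma> = 1" and e: "e = 0 \<or> e = 1"
    unfolding \<sigma>_def e_def by presburger+
  have t: "2 * t \<le> s" "- s \<le> 2 * t"
    using nearest_rem_bounds[of "n div 2"] s_gt_1 unfolding t_def by linarith+
  have near: "8 * near_cost = 2 * k * (s\<^sup>2 - \<sigma>) + 4 * \<bar>t\<bar> * (t + 1)"
    unfolding k_def t_def \<sigma>_def by (rule costs_eq)
  have "8 * near_cost \<le> (n div s) * (s\<^sup>2 - \<sigma>) + 2 * s * (n mod s + 1)"
    using half_quot_rem[folded k_def t_def e_def \<sigma>_def]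
  proof (elim disjE conjE)
    assume *: "n div s = 2 * k" "n mod s = 2 * t + e" "0 \<le> t"
    have "2 * t * (2 * t + 2) \<le> s * (2 * t + 2)"
      by (rule mult_right_mono) (use t * in auto)
    also have "\<dots> \<le> s * (4 * t + 2 * e + 2)"
      by (rule mult_left_mono) (use * e s_gt_1 in auto)
    finally show ?thesis
      using * near by (simp add: algebra_simps)
  next
    assume *: "n div s = 2 * k - 1" "n mod s = s + 2 * t + e" "t < 0"
    \<comment> \<open>This expression is exactly the slack of the claim in this case.\<close>
    have "0 \<le> (s + 2 * t)\<^sup>2 + 2 * (s + 2 * t) + \<sigma> + 2 * s * e"
    proof -
      have "0 \<le> (s + 2 * t)\<^sup>2" "0 \<le> s + 2 * t" "0 \<le> \<sigma>" "0 \<le> 2 * s * e"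
        using t s_gt_1 e \<sigma> by auto
      then show ?thesis
        by (intro add_nonneg_nonneg) simp_all
    qed
    then show ?thesis
      unfolding *(1,2) using *(3) near by (simp add: algebra_simps power2_eq_square)
  next
    assume *: "n div s = 2 * k + 1" "n mod s = e - \<sigma>" "2 * t = s - \<sigma>" "\<sigma> \<le> e"
    then have "s = 2 * t + \<sigma>" "0 \<le> t" using s_gt_1 \<sigma> by auto
    then show ?thesis
      using * \<sigma> e near by (auto simp: power2_eq_square algebra_simps)
  qed
  then show ?thesis
    by (simp add: \<sigma>_def)
qed

text \<open>With quotient \<open>s\<close> and remainder 0 the two costs coincide: the loads of both
  arc types are balanced. The borrowing case of \<open>half_quot_rem\<close> cannot occur.\<close>

lemma costs_square:
  assumes "n = s\<^sup>2"
  shows "8 * far_cost = s * (s\<^sup>2 - s mod 2)" "8 * near_cost = s * (s\<^sup>2 - s mod 2)"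
proof -
  define k t e where "k = nearest_quot (n div 2)" and "t = nearest_rem (n div 2)" and "e = n mod 2"
  define \<sigma> where "\<sigma> = s mod 2"
  have \<sigma>: "\<sigma> = 0 \<or> \<sigma> = 1" and e: "e = 0 \<or> e = 1"
    unfolding \<sigma>_def e_def by presburger+
  have far: "8 * far_cost = 4 * s * k * k + 8 * k * t + 4 * k * \<sigma>"
    unfolding k_def t_def \<sigma>_def by (rule costs_eq)
  have near: "8 * near_cost = 2 * k * (s\<^sup>2 - \<sigma>) + 4 * \<bar>t\<bar> * (t + 1)"
    unfolding k_def t_def \<sigma>_def by (rule costs_eq)
  have qr: "n div s = s" "n mod s = 0"
    using assms s_gt_1 by (simp_all add: power2_eq_square)
  have "8 * far_cost = s * (s\<^sup>2 - \<sigma>) \<and> 8 * near_cost = s * (s\<^sup>2 - \<sigma>)"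
    using half_quot_rem[folded k_def t_def e_def \<sigma>_def] unfolding qr
  proof (elim disjE conjE)
    assume *: "s = 2 * k" "0 = 2 * t + e" "0 \<le> t"
    then have "t = 0" "\<sigma> = 0" using e by (auto simp: \<sigma>_def)
    with * far near show ?thesis
      by (simp add: power2_eq_square algebra_simps)
  next
    assume "s = 2 * k - 1" "0 = s + 2 * t + e" "t < 0"
    then have False
      using nearest_rem_bounds(1)[of "n div 2"] e unfolding t_def by linarith
    then show ?thesis ..
  next
    assume *: "s = 2 * k + 1" "2 * t = s - \<sigma>"
    then have "\<sigma> = 1" by (simp add: \<sigma>_def)
    moreover from this * have "t = k" by simp
    ultimately show ?thesis
      using * s_gt_1 far near by (simp add: power2_eq_square algebra_simps)
  qed
  then show "8 * far_cost = s * (s\<^sup>2 - s mod 2)" "8 * near_cost = s * (s\<^sup>2 - s mod 2)"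
    by (simp_all add: \<sigma>_def)
qed

end

section \<open>Bounds on the forwarding indices\<close>

lemma sum_triangle:
  fixes N :: int
  assumes "int M \<le> N"
  shows "(\<Sum>b = - N..N. max 0 (int M - \<bar>b\<bar>)) = (int M)\<^sup>2"
  using assms
proof (induction M)
  case (Suc M)
  \<comment> \<open>Raising \<open>M\<close> by one adds 1 at each of the \<open>2 * M + 1\<close>
    points with \<open>\<bar>b\<bar> \<le> M\<close>, so the total is a sum of odd numbers.\<close>
  have "max 0 (int (Suc M) - \<bar>b\<bar>) = max 0 (int M - \<bar>b\<bar>) + (if b \<in> {- int M..int M} then 1 else 0)"
    for b :: int
    by auto
  then have "(\<Sum>b = - N..N. max 0 (int (Suc M) - \<bar>b\<bar>)) =
      (\<Sum>b = - N..N. max 0 (int M - \<bar>b\<bar>)) + (\<Sum>b \<in> {- N..N} \<inter> {- int M..int M}. 1)"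
    by (simp only: sum.distrib sum.inter_restrict[OF finite_atLeastAtMost_int])
  also have "{- N..N} \<inter> {- int M..int M} = {- int M..int M}"
    using Suc.prems by auto
  finally show ?case
    using Suc by (simp add: power2_eq_square algebra_simps)
qed simp

lemma sum_triangle_squares:
  fixes N :: int
  assumes "int M \<le> N"
  shows "3 * (\<Sum>a = - N..N. (max 0 (int M - \<bar>a\<bar>))\<^sup>2) = 2 * int M ^ 3 + int M"
  using assms
proof (induction M)
  case (Suc M)
  \<comment> \<open>Where the base grows from x to x + 1 its square grows by x + (x + 1), so the
    increment consists of two sums given by \<open>sum_triangle\<close>.\<close>
  have "(max 0 (int (Suc M) - \<bar>a\<bar>))\<^sup>2 =
      (max 0 (int M - \<bar>a\<bar>))\<^sup>2 + (max 0 (int M - \<bar>a\<bar>) + max 0 (int (Suc M) - \<bar>a\<bar>))"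
    for a :: int
  proof (cases "\<bar>a\<bar> \<le> int M")
    case True
    then have "max 0 (int (Suc M) - \<bar>a\<bar>) = max 0 (int M - \<bar>a\<bar>) + 1"
      by auto
    then show ?thesis
      by (simp add: power2_eq_square algebra_simps)
  qed auto
  then have "(\<Sum>a = - N..N. (max 0 (int (Suc M) - \<bar>a\<bar>))\<^sup>2) =
      (\<Sum>a = - N..N. (max 0 (int M - \<bar>a\<bar>))\<^sup>2) + ((int M)\<^sup>2 + (int (Suc M))\<^sup>2)"
    using sum_triangle[of M N] sum_triangle[of "Suc M" N] Suc.prems
    by (simp only: sum.distrib)
  then show ?case
    using Suc by (simp add: power2_eq_square power3_eq_cube algebra_simps)
qed simp

text \<open>The sum is the octahedral number K(2K^2 + 1)/3: the slice at fixed \<open>a\<close> is a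
  triangle sum, hence a square.\<close>

lemma sum_octahedron:
  fixes K :: nat
  shows "3 * (\<Sum>(a, b) \<in> {- int K..int K} \<times> {- int K..int K}. max 0 (int K - \<bar>a\<bar> - \<bar>b\<bar>)) =
    2 * int K ^ 3 + int K"
proof -
  have "(\<Sum>b = - int K..int K. max 0 (int K - \<bar>a\<bar> - \<bar>b\<bar>)) = (max 0 (int K - \<bar>a\<bar>))\<^sup>2"
    if "a \<in> {- int K..int K}" for a
  proof -
    have M: "int (nat (int K - \<bar>a\<bar>)) = int K - \<bar>a\<bar>"
      using that by auto
    then show ?thesis
      using sum_triangle[of "nat (int K - \<bar>a\<bar>)" "int K", unfolded M] that by auto
  qed
  then have "(\<Sum>(a, b) \<in> {- int K..int K} \<times> {- int K..int K}. max 0 (int K - \<bar>a\<bar> - \<bar>b\<bar>)) =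
      (\<Sum>a = - int K..int K. (max 0 (int K - \<bar>a\<bar>))\<^sup>2)"
    by (simp add: sum.cartesian_product[symmetric])
  then show ?thesis
    using sum_triangle_squares[of K "int K"] by simp
qed

context circulant
begin

section \<open>The routing by nearest division\<close>

lemma sum_folded:
  fixes f :: "int \<Rightarrow> 'b::comm_monoid_add"
  shows "(\<Sum>z = n div 2 + 1..<n. f z) = (\<Sum>z = 1..n - 1 - n div 2. f (n - z))"
  by (rule sum.reindex_bij_witness[of _ "\<lambda>z. n - z" "\<lambda>z. n - z"]) auto

lemma sum_split_half:
  fixes f :: "int \<Rightarrow> 'b::comm_monoid_add"
  shows "(\<Sum>z = 1..<n. f z) = (\<Sum>z = 1..n div 2. f z) + (\<Sum>z = 1..n - 1 - n div 2. f (n - z))"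
proof -
  have "{1..<n} = {1..n div 2} \<union> {n div 2 + 1..<n}"
    using n_ge_5 by auto
  then have "(\<Sum>z = 1..<n. f z) = (\<Sum>z = 1..n div 2. f z) + (\<Sum>z = n div 2 + 1..<n. f z)"
    by (simp only:) (rule sum.union_disjoint, auto)
  then show ?thesis
    by (simp only: sum_folded)
qed

text \<open>Opposite residues receive opposite displacements. For even \<open>n\<close> the residue
  \<open>n div 2\<close> is its own negative and takes the value of \<open>f\<close>.\<close>

definition antisymmetric_extension :: "(int \<Rightarrow> int) \<Rightarrow> int \<Rightarrow> int" where
  "antisymmetric_extension f z = (if z \<le> n div 2 then f z else - f (n - z))"

text \<open>The lower half contributes the positive parts of \<open>f\<close>, the mirrored upper
  half its negative parts; together they give absolute values. For even \<open>n\<close> the upper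
  half has one residue fewer, hence an inequality.\<close>

lemma sum_pos_part_antisymmetric_extension:
  "(\<Sum>z = 1..<n. max 0 (antisymmetric_extension f z)) \<le> (\<Sum>z = 1..n div 2. \<bar>f z\<bar>)"
  "(\<Sum>z = 1..<n. max 0 (- antisymmetric_extension f z)) \<le> (\<Sum>z = 1..n div 2. \<bar>f z\<bar>)"
proof -
  have *: "(\<Sum>z = 1..<n. max 0 (antisymmetric_extension g z)) \<le> (\<Sum>z = 1..n div 2. \<bar>g z\<bar>)" for g
  proof -
    have "(\<Sum>z = 1..n - 1 - n div 2. max 0 (antisymmetric_extension g (n - z))) =
        (\<Sum>z = 1..n - 1 - n div 2. max 0 (- g z))"
      by (rule sum.cong) (auto simp: antisymmetric_extension_def)
    also have "\<dots> \<le> (\<Sum>z = 1..n div 2. max 0 (- g z))"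
      by (rule sum_mono2) auto
    finally have "(\<Sum>z = 1..<n. max 0 (antisymmetric_extension g z)) \<le>
        (\<Sum>z = 1..n div 2. max 0 (g z)) + (\<Sum>z = 1..n div 2. max 0 (- g z))"
      unfolding sum_split_half by (simp add: antisymmetric_extension_def)
    also have "\<dots> = (\<Sum>z = 1..n div 2. \<bar>g z\<bar>)"
      unfolding sum.distrib[symmetric] by (rule sum.cong) auto
    finally show ?thesis .
  qed
  show "(\<Sum>z = 1..<n. max 0 (antisymmetric_extension f z)) \<le> (\<Sum>z = 1..n div 2. \<bar>f z\<bar>)"
    by (rule *)
  have "- antisymmetric_extension f z = antisymmetric_extension (\<lambda>z. - f z) z" for z
    by (simp add: antisymmetric_extension_def)
  then show "(\<Sum>z = 1..<n. max 0 (- antisymmetric_extension f z)) \<le> (\<Sum>z = 1..n div 2. \<bar>f z\<bar>)"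
    using *[of "\<lambda>z. - f z"] by simp
qed

lemma routing_nearest:
  obtains R where "all_to_all_routing (circulant2 n s) R"
    and "int (max_arc_load (circulant2 n s) R) \<le> max near_cost far_cost"
proof (rule routing_of_displacements)
  fix z assume "z \<in> {1..<n}"
  have eq: "nearest_rem y + nearest_quot y * s = y" for y
    using nearest_quot_rem[of y] by (simp add: algebra_simps)
  show "[antisymmetric_extension nearest_rem z + antisymmetric_extension nearest_quot z * s = z] (mod n)"
  proof (cases "z \<le> n div 2")
    case True
    then show ?thesis
      by (simp add: antisymmetric_extension_def eq)
  next
    case False
    then have "antisymmetric_extension nearest_rem z + antisymmetric_extension nearest_quot z * s =
        - (nearest_rem (n - z) + nearest_quot (n - z) * s)"
      by (simp add: antisymmetric_extension_def)
    then show ?thesis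
      unfolding eq by (simp add: cong_iff_dvd_diff)
  qed
next
  have far: "(\<Sum>z = 1..n div 2. \<bar>nearest_quot z\<bar>) = far_cost"
    unfolding far_cost_def by (rule sum.cong) (auto simp: nearest_quot_nonneg)
  note near = near_cost_def[symmetric]
  show "(\<Sum>z = 1..<n. max 0 (antisymmetric_extension nearest_rem z)) \<le> max near_cost far_cost"
    "(\<Sum>z = 1..<n. max 0 (- antisymmetric_extension nearest_rem z)) \<le> max near_cost far_cost"
    "(\<Sum>z = 1..<n. max 0 (antisymmetric_extension nearest_quot z)) \<le> max near_cost far_cost"
    "(\<Sum>z = 1..<n. max 0 (- antisymmetric_extension nearest_quot z)) \<le> max near_cost far_cost"
    using sum_pos_part_antisymmetric_extension[of nearest_rem, unfolded near]
      sum_pos_part_antisymmetric_extension[of nearest_quot, unfolded far]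
    by linarith+
qed

lemma arc_forwarding_index_circulant2_le:
  "int (arc_forwarding_index (circulant2 n s)) \<le> max near_cost far_cost"
proof -
  obtain R where "all_to_all_routing (circulant2 n s) R"
    "int (max_arc_load (circulant2 n s) R) \<le> max near_cost far_cost"
    by (rule routing_nearest)
  with arc_forwarding_index_le[of "circulant2 n s" R] show ?thesis
    by linarith
qed

lemma edge_forwarding_index_circulant2_le:
  "edge_forwarding_index (circulant2 n s) \<le> 2 * arc_forwarding_index (circulant2 n s)"
proof -
  obtain R where "all_to_all_routing (circulant2 n s) R"
    by (rule routing_nearest)
  then show ?thesis
    using parcs_nonempty by (rule edge_forwarding_index_le_twice_arc_forwarding_index)
qed

section \<open>Lower bounds on the edge-forwarding index\<close>

lemma displacement_weight_le_edge_forwarding_index: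
  fixes w1 ws :: real and d :: "int \<Rightarrow> real"
  assumes "0 \<le> w1" "0 \<le> ws"
    and "\<And>z a b. z \<in> {1..<n} \<Longrightarrow> [a + b * s = z] (mod n) \<Longrightarrow>
      d z \<le> w1 * \<bar>real_of_int a\<bar> + ws * \<bar>real_of_int b\<bar>"
  shows "(\<Sum>z = 1..<n. d z) \<le> edge_forwarding_index (circulant2 n s) * (w1 + ws)"
proof -
  obtain R where "all_to_all_routing (circulant2 n s) R"
    by (rule routing_nearest)
  then obtain R' where "all_to_all_routing (circulant2 n s) R'"
    "edge_forwarding_index (circulant2 n s) = max_edge_load (circulant2 n s) R'"
    by (rule edge_forwarding_index_attained)
  then show ?thesis
    using displacement_weight_le_load[of R' w1 ws d] assms by simp
qed

text \<open>Negating \<open>(a, b)\<close> turns a displacement for \<open>z\<close> into one for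
  \<open>n - z\<close> of equal weight, so estimates for \<open>z \<le> n div 2\<close> suffice. For
  even \<open>n\<close> the middle residue must be counted once only, hence the subtraction.\<close>

lemma symmetric_displacement_weight_le:
  fixes w1 ws :: real and d :: "int \<Rightarrow> real"
  assumes w: "0 \<le> w1" "0 \<le> ws"
    and d: "\<And>z a b. 1 \<le> z \<Longrightarrow> z \<le> n div 2 \<Longrightarrow> [a + b * s = z] (mod n) \<Longrightarrow>
      d z \<le> w1 * \<bar>real_of_int a\<bar> + ws * \<bar>real_of_int b\<bar>"
  shows "2 * (\<Sum>z = 1..n div 2. d z) - (if even n then d (n div 2) else 0)
    \<le> edge_forwarding_index (circulant2 n s) * (w1 + ws)"
proof -
  define d' where "d' z = (if z \<le> n div 2 then d z else d (n - z))" for z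
  have "(\<Sum>z = 1..<n. d' z) \<le> edge_forwarding_index (circulant2 n s) * (w1 + ws)"
  proof (rule displacement_weight_le_edge_forwarding_index[OF w])
    fix z a b assume z: "z \<in> {1..<n}" and ab: "[a + b * s = z] (mod n)"
    show "d' z \<le> w1 * \<bar>real_of_int a\<bar> + ws * \<bar>real_of_int b\<bar>"
    proof (cases "z \<le> n div 2")
      case True
      then show ?thesis
        using d[of z a b] z ab by (simp add: d'_def)
    next
      case False
      have "n dvd - (a + b * s - z) - n"
        using ab by (intro dvd_diff) (simp_all only: cong_iff_dvd_diff dvd_minus_iff dvd_refl)
      then have "[- a + - b * s = n - z] (mod n)"
        by (simp add: cong_iff_dvd_diff algebra_simps)
      moreover have "1 \<le> n - z" "n - z \<le> n div 2"
        using False z by auto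
      ultimately show ?thesis
        using d[of "n - z" "- a" "- b"] False by (simp add: d'_def)
    qed
  qed
  moreover have "(\<Sum>z = 1..<n. d' z) = (\<Sum>z = 1..n div 2. d z) + (\<Sum>z = 1..n - 1 - n div 2. d z)"
    unfolding sum_split_half by (auto simp: d'_def intro!: sum.cong arg_cong2[of _ _ _ _ "(+)"])
  moreover have "(\<Sum>z = 1..n - 1 - n div 2. d z) =
      (\<Sum>z = 1..n div 2. d z) - (if even n then d (n div 2) else 0)"
  proof (cases "even n")
    case True
    then have half: "n - 1 - n div 2 + 1 = n div 2" and "0 \<le> n - 1 - n div 2"
      using n_ge_5 by auto
    then show ?thesis
      using sum_atLeastAtMost_plus1_int[of "n - 1 - n div 2" d, unfolded half] True by simp
  next
    case False
    then have "n - 1 - n div 2 = n div 2"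
      by presburger
    then show ?thesis
      using False by simp
  qed
  ultimately show ?thesis
    by simp
qed

text \<open>The weight \<open>\<bar>a\<bar> + s * \<bar>b\<bar>\<close> is at least
  \<open>\<bar>a + b * s\<bar>\<close>, and an integer congruent to \<open>z\<close> with
  \<open>z \<le> n div 2\<close> has absolute value at least \<open>z\<close>. These
  \<open>z\<close>, counted for both halves, sum to \<open>(n^2 - eps n) / 4\<close>.\<close>

lemma edge_forwarding_index_ge_cyclic:
  "(real_of_int n ^ 2 - eps n) / 4 \<le> edge_forwarding_index (circulant2 n s) * (1 + s)"
proof -
  have "2 * (\<Sum>z = 1..n div 2. real_of_int z) - (if even n then real_of_int (n div 2) else 0)
      \<le> edge_forwarding_index (circulant2 n s) * (1 + real_of_int s)"
  proof (rule symmetric_displacement_weight_le)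
    fix z a b assume z: "1 \<le> z" "z \<le> n div 2" and "[a + b * s = z] (mod n)"
    then obtain j where "a + b * s - z = n * j"
      by (auto simp: cong_iff_dvd_diff)
    then have "a + b * s = z + n * j"
      by simp
    moreover have "z \<le> \<bar>z + n * j\<bar>"
    proof (cases "0 \<le> j")
      case True
      then show ?thesis
        using z n_ge_5 by simp
    next
      case False
      then have "n * j \<le> n * (-1)"
        by (intro mult_left_mono) (use n_ge_5 in auto)
      then show ?thesis
        using z by linarith
    qed
    moreover have "\<bar>a + b * s\<bar> \<le> \<bar>a\<bar> + s * \<bar>b\<bar>"
      using abs_triangle_ineq[of a "b * s"] s_gt_1 by (simp add: abs_mult mult.commute)
    ultimately have "z \<le> \<bar>a\<bar> + s * \<bar>b\<bar>"
      by simp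
    then show "real_of_int z \<le> 1 * \<bar>real_of_int a\<bar> + real_of_int s * \<bar>real_of_int b\<bar>"
      by (metis mult_1 of_int_abs of_int_add of_int_le_iff of_int_mult)
  qed (use s_gt_1 in auto)
  moreover have "2 * (\<Sum>z = 1..h. real_of_int z) = h * (h + 1)" if "0 \<le> h" for h :: int
    using that
  proof (induction h rule: int_ge_induct)
    case (step h)
    then show ?case
      unfolding sum_atLeastAtMost_plus1_int[OF step.hyps] by (simp add: algebra_simps)
  qed simp
  from this[of "n div 2"] have "2 * (\<Sum>z = 1..n div 2. real_of_int z) = (n div 2) * (n div 2 + 1)"
    using n_ge_5 by simp
  moreover have "real_of_int n = 2 * real_of_int (n div 2) + eps n"
    by (cases "even n") (auto elim!: evenE oddE simp: eps_def)
  ultimately show ?thesis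
    by (cases "even n") (simp_all add: eps_def power2_eq_square algebra_simps)
qed

text \<open>For \<open>n = s^2\<close> every displacement of \<open>z\<close> has the form
  \<open>(\<alpha> + s * k, \<beta> + s * j - k)\<close>. A nonzero \<open>k\<close> makes the first
  coordinate grow by at least as much as the second can shrink, except at the tie
  \<open>2 * \<alpha> = s\<close>.\<close>

lemma nearest_shortest:
  assumes n: "n = s\<^sup>2" and z: "1 \<le> z" "z \<le> n div 2" and ab: "[a + b * s = z] (mod n)"
  shows "\<bar>nearest_rem z\<bar> + nearest_quot z \<le> \<bar>a\<bar> + \<bar>b\<bar>"
proof -
  define \<alpha> \<beta> where "\<alpha> = nearest_rem z" and "\<beta> = nearest_quot z"
  have z_eq: "z = s * \<beta> + \<alpha>"
    using nearest_quot_rem[of z] by (simp add: \<alpha>_def \<beta>_def)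
  have \<alpha>: "2 * \<alpha> \<le> s" "- (s - 1) \<le> 2 * \<alpha>"
    using nearest_rem_bounds[of z] s_gt_1 unfolding \<alpha>_def by linarith+
  have \<beta>0: "0 \<le> \<beta>"
    using nearest_quot_nonneg z by (simp add: \<beta>_def)
  have z2: "2 * (s * \<beta> + \<alpha>) \<le> s * s"
    using z z_eq n by (simp add: power2_eq_square)
  \<comment> \<open>From \<open>2 * z \<le> s * s\<close>; at the tie the positive remainder
    \<open>s / 2\<close> leaves room for the extra 1.\<close>
  have \<beta>: "2 * \<beta> + (if 2 * \<alpha> = s then 1 else 0) \<le> s"
  proof -
    have "s * (2 * \<beta>) < s * (s + 1)"
      using z2 \<alpha> by (simp add: algebra_simps)
    then have "2 * \<beta> < s + 1"
      using s_gt_1 by simp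
    moreover have "2 * \<beta> + 1 \<le> s" if "2 * \<alpha> = s"
    proof -
      have "s * (2 * \<beta> + 1) \<le> s * s"
        using z2 that by (simp add: algebra_simps)
      then show ?thesis
        using s_gt_1 by simp
    qed
    ultimately show ?thesis by auto
  qed
  obtain j where "a + b * s - z = n * j"
    using ab by (auto simp: cong_iff_dvd_diff)
  then have a: "a + b * s = s * \<beta> + \<alpha> + s * s * j"
    using z_eq n by (simp add: power2_eq_square)
  define k where "k = \<beta> + s * j - b"
  have a: "a = \<alpha> + s * k" and b: "b = \<beta> + s * j - k"
    using a by (simp_all add: k_def algebra_simps)
  have far: "\<beta> \<le> \<bar>\<beta> + s * j\<bar>"
  proof (cases "0 \<le> j")
    case True
    then show ?thesis using s_gt_1 \<beta>0 by simp
  next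
    case False
    then have "s * j \<le> s * (-1)"
      by (intro mult_left_mono) (use s_gt_1 in auto)
    then show ?thesis using \<beta> by (auto split: if_splits)
  qed
  have "\<bar>\<alpha>\<bar> + \<beta> \<le> \<bar>\<alpha> + s * k\<bar> + \<bar>\<beta> + s * j - k\<bar>"
  proof (cases "k = 0")
    case True
    then show ?thesis using far by simp
  next
    case k: False
    show ?thesis
    proof (cases "2 * \<alpha> = s")
      case False
      \<comment> \<open>Off the tie \<open>2 * \<bar>\<alpha>\<bar> \<le> s - 1\<close>, so
        \<open>\<bar>\<alpha> + s * k\<bar>\<close> is at least
        \<open>\<bar>\<alpha>\<bar> + \<bar>k\<bar>\<close>, which pays for the shift by
        \<open>k\<close> in the second coordinate.\<close>
      have "(s - 1) * 1 \<le> (s - 1) * \<bar>k\<bar>"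
        by (rule mult_left_mono) (use k s_gt_1 in auto)
      then have "s - 1 + \<bar>k\<bar> \<le> \<bar>s * k\<bar>"
        using s_gt_1 by (simp add: abs_mult algebra_simps)
      then show ?thesis
        using far False \<alpha> by linarith
    next
      case True
      show ?thesis
      \<comment> \<open>At the tie \<open>k = -1\<close> only flips the sign of the remainder
        \<open>s / 2\<close>, and the sharper bound on \<open>\<beta>\<close> is needed. Any other
        nonzero \<open>k\<close> makes the first coordinate at least \<open>3 * s / 2\<close> in
        absolute value.\<close>
      proof (cases "k = -1")
        case k: True
        have "\<beta> \<le> \<bar>\<beta> + s * j + 1\<bar>"
        proof (cases "0 \<le> j")
          case True
          then have "0 \<le> s * j" using s_gt_1 by simp
          then show ?thesis using \<beta>0 by linarith
        next
          case False
          then have "s * j \<le> s * (-1)"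
            by (intro mult_left_mono) (use s_gt_1 in auto)
          then show ?thesis using \<beta> True by simp
        qed
        then show ?thesis
          using k True s_gt_1 by simp
      next
        case False
        with k have "1 \<le> k \<or> k \<le> -2" by auto
        then have "s * 1 \<le> s * k \<or> s * k \<le> s * (-2)"
          using s_gt_1 by (auto simp del: mult_1_right mult_minus_right)
        moreover have "2 * \<beta> + 1 \<le> s"
          using True \<beta> by simp
        ultimately show ?thesis
          using True \<beta>0 by linarith
      qed
    qed
  qed
  then show ?thesis
    by (simp add: a b \<alpha>_def \<beta>_def)
qed

lemma edge_forwarding_index_ge_square:
  assumes "n = s\<^sup>2"
  shows "real_of_int s * (real_of_int n - 1) \<le> 4 * edge_forwarding_index (circulant2 n s)"
proof -
  let ?d = "\<lambda>z. real_of_int (\<bar>nearest_rem z\<bar> + nearest_quot z)"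
  define S where "S = (\<Sum>z = 1..n div 2. ?d z)"
  define I where "I = (if even n then ?d (n div 2) else 0)"
  have "2 * S - I \<le> real (edge_forwarding_index (circulant2 n s)) * (1 + 1)"
    unfolding S_def I_def
  proof (rule symmetric_displacement_weight_le)
    fix z a b assume "1 \<le> z" "z \<le> n div 2" "[a + b * s = z] (mod n)"
    then have "?d z \<le> real_of_int (\<bar>a\<bar> + \<bar>b\<bar>)"
      using nearest_shortest[OF assms] of_int_le_iff by blast
    then show "?d z \<le> 1 * \<bar>real_of_int a\<bar> + 1 * \<bar>real_of_int b\<bar>"
      by simp
  qed auto
  moreover have "8 * S = real_of_int (2 * (s * (s\<^sup>2 - s mod 2)))"
  proof -
    have "S = real_of_int (near_cost + far_cost)"
      by (simp add: S_def near_cost_def far_cost_def sum.distrib)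
    moreover have "8 * (near_cost + far_cost) = 2 * (s * (s\<^sup>2 - s mod 2))"
      using costs_square[OF assms] by simp
    ultimately show ?thesis
      by (metis of_int_mult of_int_numeral)
  qed
  moreover have "real_of_int (2 * (s * (s\<^sup>2 - s mod 2))) - 4 * I
      = 2 * (real_of_int s * (real_of_int n - 1))"
  \<comment> \<open>For even \<open>s\<close> the middle residue is \<open>s * (s / 2)\<close>, with
    remainder 0 and quotient \<open>s / 2\<close>; subtracting it turns \<open>s^2\<close> into
    \<open>n - 1\<close>. For odd \<open>s\<close> the term \<open>s mod 2\<close> does this
    already.\<close>
  proof (cases "even s")
    case True
    then obtain m where m: "s = 2 * m" by blast
    then have half: "n div 2 = s * m + 0"
      by (simp add: assms power2_eq_square)
    have "?d (n div 2) = real_of_int m"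
      unfolding half using nearest_unique[of 0 m] s_gt_1 m by simp
    moreover have "even n" "s mod 2 = 0"
      using True assms by auto
    ultimately show ?thesis
      using m by (simp add: I_def assms algebra_simps)
  next
    case False
    then have "s mod 2 = 1" by presburger
    then show ?thesis
      using False by (simp add: I_def assms)
  qed
  ultimately show ?thesis
    by simp
qed

text \<open>For a vertex \<open>z\<close> this is the graph distance from 0 to \<open>z\<close>,
  computed in the lattice of displacements.\<close>

definition displacement_norm :: "int \<Rightarrow> nat" where
  "displacement_norm z = (LEAST k. \<exists>a b. [a + b * s = z] (mod n) \<and> k = nat (\<bar>a\<bar> + \<bar>b\<bar>))"

lemma displacement_norm_attained:
  "\<exists>a b. [a + b * s = z] (mod n) \<and> int (displacement_norm z) = \<bar>a\<bar> + \<bar>b\<bar>"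
proof -
  have "\<exists>a b. [a + b * s = z] (mod n) \<and> displacement_norm z = nat (\<bar>a\<bar> + \<bar>b\<bar>)"
    unfolding displacement_norm_def by (rule LeastI_ex) (metis add_0_right cong_refl mult_zero_left)
  then obtain a b where "[a + b * s = z] (mod n)" "displacement_norm z = nat (\<bar>a\<bar> + \<bar>b\<bar>)"
    by blast
  then show ?thesis
    by (intro exI[of _ a] exI[of _ b]) simp
qed

lemma displacement_norm_le:
  "[a + b * s = z] (mod n) \<Longrightarrow> int (displacement_norm z) \<le> \<bar>a\<bar> + \<bar>b\<bar>"
  unfolding displacement_norm_def
  by (rule order.trans[OF of_nat_mono[OF Least_le[of _ "nat (\<bar>a\<bar> + \<bar>b\<bar>)"]]]) auto

text \<open>
  Residues are the images of distinct lattice points \<open>(a, b)\<close>, so the truncated distances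
  \<open>max 0 (K - d z)\<close> sum to at most their total over the whole lattice.
\<close>

lemma sum_displacement_norm_ge:
  "3 * (n * int K - (\<Sum>z = 1..<n. int (displacement_norm z))) \<le> 2 * int K ^ 3 + int K"
proof -
  obtain A B where AB: "\<And>z. [A z + B z * s = z] (mod n)"
    "\<And>z. int (displacement_norm z) = \<bar>A z\<bar> + \<bar>B z\<bar>"
    using displacement_norm_attained by metis
  let ?Z = "{z \<in> {0..<n}. int (displacement_norm z) \<le> int K}"
  let ?Q = "{- int K..int K} \<times> {- int K..int K}"
  have inj: "inj_on (\<lambda>z. (A z, B z)) ?Z"
    by (rule inj_onI) (metis (mono_tags, lifting) AB(1) cong_imp_eq_vertex cong_sym cong_trans
        mem_Collect_eq prod.inject)
  have "n * int K - (\<Sum>z = 0..<n. int (displacement_norm z)) =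
      (\<Sum>z = 0..<n. int K - int (displacement_norm z))"
    using n_ge_5 by (simp add: sum_subtractf)
  also have "\<dots> \<le> (\<Sum>z \<in> {0..<n}. max 0 (int K - int (displacement_norm z)))"
    by (rule sum_mono) simp
  also have "\<dots> = (\<Sum>z \<in> ?Z. max 0 (int K - int (displacement_norm z)))"
    by (rule sum.mono_neutral_right) auto
  also have "\<dots> = (\<Sum>(a, b) \<in> (\<lambda>z. (A z, B z)) ` ?Z. max 0 (int K - \<bar>a\<bar> - \<bar>b\<bar>))"
    by (subst sum.reindex[OF inj]) (simp add: AB(2) diff_diff_eq)
  also have "\<dots> \<le> (\<Sum>(a, b) \<in> ?Q. max 0 (int K - \<bar>a\<bar> - \<bar>b\<bar>))"
    by (rule sum_mono2) (auto simp: AB(2))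
  finally have "3 * (n * int K - (\<Sum>z = 0..<n. int (displacement_norm z))) \<le>
      3 * (\<Sum>(a, b) \<in> ?Q. max 0 (int K - \<bar>a\<bar> - \<bar>b\<bar>))"
    by (rule mult_left_mono) simp
  also note sum_octahedron
  finally have "3 * (n * int K - (\<Sum>z = 0..<n. int (displacement_norm z))) \<le> 2 * int K ^ 3 + int K" .
  moreover have "{0..<n} = insert 0 {1..<n}"
    using n_ge_5 by auto
  moreover have "displacement_norm 0 = 0"
    using displacement_norm_le[of 0 0 0] by simp
  ultimately show ?thesis
    by simp
qed

text \<open>Unit weights bound the sum of distances by twice the index; the previous lemma bounds it
  below. The radius \<open>K\<close> is left free for optimization.\<close>

lemma edge_forwarding_index_ge_ball:
  "3 * (real_of_int n * real K) - (2 * real K ^ 3 + real K) \<le> 6 * edge_forwarding_index (circulant2 n s)"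
proof -
  have "(\<Sum>z = 1..<n. real (displacement_norm z)) \<le> real (edge_forwarding_index (circulant2 n s)) * (1 + 1)"
  proof (rule displacement_weight_le_edge_forwarding_index)
    fix z a b assume "[a + b * s = z] (mod n)"
    then have "real_of_int (int (displacement_norm z)) \<le> real_of_int (\<bar>a\<bar> + \<bar>b\<bar>)"
      using displacement_norm_le of_int_le_iff by blast
    then show "real (displacement_norm z) \<le> 1 * \<bar>real_of_int a\<bar> + 1 * \<bar>real_of_int b\<bar>"
      by simp
  qed auto
  moreover have "real_of_int (3 * (n * int K - (\<Sum>z = 1..<n. int (displacement_norm z)))) \<le>
      real_of_int (2 * int K ^ 3 + int K)"
    using sum_displacement_norm_ge of_int_le_iff by blast
  ultimately show ?thesis
    by simp
qed

text \<open>The radius \<open>K = \<lfloor>sqrt (n / 2)\<rfloor>\<close> nearly maximizes the left-hand side of the previous lemma.\<close>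

lemma edge_forwarding_index_ge_sqrt:
  "(real_of_int n - 1) * (sqrt (2 * real_of_int n) - 7) ^ 3 / (24 * real_of_int n)
    \<le> edge_forwarding_index (circulant2 n s) / 2"
proof -
  define w where "w = sqrt (2 * real_of_int n)"
  have n: "real_of_int n > 0"
    using n_ge_5 by simp
  then have w2: "w\<^sup>2 = 2 * real_of_int n"
    by (simp add: w_def)
  show ?thesis
    unfolding w_def[symmetric]
  proof (cases "w \<le> 7")
    case True
    then have "(w - 7) ^ 3 \<le> 0"
      by (simp add: power_le_zero_eq)
    then have "(real_of_int n - 1) * (w - 7) ^ 3 / (24 * real_of_int n) \<le> 0"
      using n_ge_5 by (simp add: divide_nonpos_pos mult_nonneg_nonpos)
    then show "(real_of_int n - 1) * (w - 7) ^ 3 / (24 * real_of_int n)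
        \<le> edge_forwarding_index (circulant2 n s) / 2"
      by (rule order.trans) simp
  next
    case False
    define K where "K = nat \<lfloor>w / 2\<rfloor>"
    \<comment> \<open>The leading terms \<open>3 * w^2 * K - 4 * K^3\<close> are maximal at
      \<open>K = w / 2\<close>; \<open>\<theta>\<close> is the rounding loss, and its first-order
      effect vanishes.\<close>
    define \<theta> where "\<theta> = w / 2 - real K"
    have K: "real K = real_of_int \<lfloor>w / 2\<rfloor>"
      using False by (simp add: K_def)
    have \<theta>: "0 \<le> \<theta>" "\<theta> \<le> 1"
      unfolding \<theta>_def K by linarith+
    have K_eq: "real K = w / 2 - \<theta>"
      by (simp add: \<theta>_def)
    have "(w - 7) ^ 3 \<le> w ^ 3 - 7 * w"
    proof -
      \<comment> \<open>Completing the square: \<open>w^3 - 7 * w - (w - 7)^3\<close> equals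
        \<open>21 * (w - 11/3)^2 + 182/3\<close>.\<close>
      have "0 \<le> 21 * (w - 11 / 3)\<^sup>2 + 60"
        by simp
      then show ?thesis
        by (simp add: power2_eq_square power3_eq_cube algebra_simps)
    qed
    \<comment> \<open>The worst case \<open>\<theta> = 1\<close> of
      \<open>6 * w * \<theta>^2\<close>, together with \<open>w\<close>, is the source of
      \<open>7 * w\<close>.\<close>
    also have "\<dots> \<le> w ^ 3 - 6 * w * \<theta>\<^sup>2 + 4 * \<theta> ^ 3 - w + 2 * \<theta>"
    proof -
      have "w * \<theta>\<^sup>2 \<le> w * 1"
        by (rule mult_left_mono) (use \<theta> False in \<open>auto simp: power_le_one\<close>)
      moreover have "0 \<le> \<theta> ^ 3"
        using \<theta> by simp
      ultimately show ?thesis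
        using \<theta> by linarith
    qed
    also have "\<dots> = 3 * w\<^sup>2 * real K - 4 * real K ^ 3 - 2 * real K"
      unfolding K_eq by (simp add: power2_eq_square power3_eq_cube field_simps)
    also have "\<dots> \<le> 12 * edge_forwarding_index (circulant2 n s)"
      using edge_forwarding_index_ge_ball[of K] unfolding w2 by simp
    finally have *: "(w - 7) ^ 3 / 24 \<le> edge_forwarding_index (circulant2 n s) / 2"
      by simp
    \<comment> \<open>The claimed bound is the one just proved times \<open>(n - 1) / n\<close>,
      which is at most 1.\<close>
    have "(real_of_int n - 1) * (w - 7) ^ 3 / (24 * real_of_int n) =
        (real_of_int n - 1) / real_of_int n * ((w - 7) ^ 3 / 24)"
      by simp
    also have "\<dots> \<le> 1 * ((w - 7) ^ 3 / 24)"
      by (rule mult_right_mono) (use n False in auto)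
    finally show "(real_of_int n - 1) * (w - 7) ^ 3 / (24 * real_of_int n)
        \<le> edge_forwarding_index (circulant2 n s) / 2"
      using * by linarith
  qed
qed

end

section \<open>Comparison of the costs in the three ranges of s\<close>

lemma eps_eq_mod: "eps x = real_of_int (x mod 2)"
  by (auto simp: eps_def odd_iff_mod_2_eq_one)

context circulant
begin

lemma edge_forwarding_index_ge_cyclic':
  "(real_of_int n ^ 2 - eps n) / (8 * (real_of_int s + 1))
    \<le> edge_forwarding_index (circulant2 n s) / 2"
  using edge_forwarding_index_ge_cyclic s_gt_1 by (simp add: divide_simps) (simp add: algebra_simps)

lemma half_edge_forwarding_index_circulant2_le:
  "real (edge_forwarding_index (circulant2 n s)) / 2 \<le> real (arc_forwarding_index (circulant2 n s))"
  using edge_forwarding_index_circulant2_le by linarith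

text \<open>Here the quotient exceeds \<open>s + 1\<close>, so the bound on \<open>far_cost\<close>
  dominates the one on \<open>near_cost\<close>.\<close>

lemma arc_forwarding_index_small_step:
  assumes "(s + 1)\<^sup>2 \<le> n"
  shows "8 * int (arc_forwarding_index (circulant2 n s)) \<le> s * (n div s)\<^sup>2 + 2 * (n div s) * (n mod s + 1) + s"
proof -
  define q r where "q = n div s" and "r = n mod s"
  have r: "0 \<le> r" "r < s" and n: "n = q * s + r"
    using s_gt_1 by (simp_all add: q_def r_def)
  have "s * (s + 1) < s * q"
    using assms r n s_gt_1 by (simp add: power2_eq_square algebra_simps)
  then have q: "s + 1 < q"
    using s_gt_1 by simp
  have "q * (s * s) \<le> q * (s * q)"
    using q s_gt_1 by (intro mult_left_mono) auto
  moreover have "s * (r + 1) \<le> q * (r + 1)"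
    using q r by (intro mult_right_mono) auto
  moreover have "0 \<le> q * (s mod 2)"
    using q s_gt_1 by (intro mult_nonneg_nonneg) auto
  ultimately have "8 * near_cost \<le> s * q\<^sup>2 + 2 * q * (r + 1) + s"
    using near_cost_le[folded q_def r_def] s_gt_1 by (simp add: power2_eq_square algebra_simps)
  moreover have "8 * far_cost \<le> s * q\<^sup>2 + 2 * q * (r + 1) + s"
    using far_cost_le[folded q_def r_def] .
  ultimately show ?thesis
    using arc_forwarding_index_circulant2_le by (simp add: q_def r_def)
qed

text \<open>Here the quotient is at most \<open>s - 2\<close>, so the bound on
  \<open>near_cost\<close> dominates.\<close>

lemma arc_forwarding_index_large_step:
  assumes "n \<le> (s - 1)\<^sup>2"
  shows "8 * int (arc_forwarding_index (circulant2 n s))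
    \<le> (n div s) * (s\<^sup>2 - s mod 2) + 2 * s * (n mod s + 1)"
proof -
  define q r \<sigma> where "q = n div s" and "r = n mod s" and "\<sigma> = s mod 2"
  have r: "0 \<le> r" "r < s" and n: "n = q * s + r" and \<sigma>: "\<sigma> \<le> 1"
    using s_gt_1 by (simp_all add: q_def r_def \<sigma>_def)
  have "s * q < s * (s - 1)"
    using assms r n s_gt_1 by (simp add: power2_eq_square algebra_simps)
  then have q: "q < s - 1"
    using s_gt_1 by simp
  have q0: "0 < q"
    using s_gt_1 s_lt by (simp add: q_def pos_imp_zdiv_pos_iff)
  \<comment> \<open>The gap of 2 between \<open>q\<close> and \<open>s\<close> leaves a reserve of
    \<open>2 * s * q\<close>, which absorbs the lower-order terms \<open>s\<close> and
    \<open>q * \<sigma>\<close>.\<close>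
  have "s * q * (q + 2) \<le> s * q * s"
    using q q0 s_gt_1 by (intro mult_left_mono) auto
  moreover have "q * (r + 1) \<le> s * (r + 1)"
    using q r by (intro mult_right_mono) auto
  moreover have "q * \<sigma> \<le> q * 1" "s * 1 \<le> s * q" "1 * q \<le> s * q"
    using q0 s_gt_1 \<sigma> by (intro mult_left_mono mult_right_mono; simp)+
  ultimately have "8 * far_cost \<le> q * (s\<^sup>2 - \<sigma>) + 2 * s * (r + 1)"
    using far_cost_le[folded q_def r_def] by (simp add: power2_eq_square algebra_simps)
  moreover have "8 * near_cost \<le> q * (s\<^sup>2 - \<sigma>) + 2 * s * (r + 1)"
    using near_cost_le[folded q_def r_def \<sigma>_def] .
  ultimately show ?thesis
    using arc_forwarding_index_circulant2_le by (simp add: q_def r_def \<sigma>_def)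
qed

lemma arc_forwarding_index_square:
  assumes "n = s\<^sup>2"
  shows "8 * int (arc_forwarding_index (circulant2 n s)) \<le> s * (n - s mod 2)"
  using arc_forwarding_index_circulant2_le costs_square[OF assms] by (simp add: assms)

end

theorem theorem1p1:
  fixes n s q r :: int
  assumes "n \<ge> 5" and "1 < s" and "real_of_int s < real_of_int n / 2"
    and "q = \<lfloor>real_of_int n / real_of_int s\<rfloor>" and "r = n - q * s"
  defines "C \<equiv> circulant2 n s"
  shows
    "(2 \<le> s \<and> real_of_int s \<le> sqrt (real_of_int n) - 1 \<longrightarrow>
        (real_of_int n ^ 2 - eps n) / (8 * (real_of_int s + 1)) \<le> real (edge_forwarding_index C) / 2 \<and>
        real (edge_forwarding_index C) / 2 \<le> real (arc_forwarding_index C) \<and>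
        real (arc_forwarding_index C)
          \<le> ((real_of_int n - real_of_int r) * (real_of_int n + real_of_int r + 2) + real_of_int s ^ 2)
             / (8 * real_of_int s)) \<and>
     (real_of_int s = sqrt (real_of_int n) \<longrightarrow>
        sqrt (real_of_int n) * (real_of_int n - 1) / 8 \<le> real (edge_forwarding_index C) / 2 \<and>
        real (edge_forwarding_index C) / 2 \<le> real (arc_forwarding_index C) \<and>
        real (arc_forwarding_index C) \<le> sqrt (real_of_int n) * (real_of_int n - eps s) / 8) \<and>
     (sqrt (real_of_int n) + 1 \<le> real_of_int s \<and> real_of_int s < real_of_int n / 2 \<longrightarrow>
        max ((real_of_int n ^ 2 - eps n) / (8 * (real_of_int s + 1)))
            ((real_of_int n - 1) * (sqrt (2 * real_of_int n) - 7) ^ 3 / (24 * real_of_int n))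
          \<le> real (edge_forwarding_index C) / 2 \<and>
        real (edge_forwarding_index C) / 2 \<le> real (arc_forwarding_index C) \<and>
        real (arc_forwarding_index C)
          \<le> (real_of_int s ^ 2 * (real_of_int n + real_of_int r + 2)
               - eps s * (real_of_int n - real_of_int r)) / (8 * real_of_int s))"
proof -
  interpret circulant n s
    using assms(2,3) by unfold_locales linarith+
  have q: "n div s = q"
    using assms(4) by (simp add: floor_divide_of_int_eq)
  have r: "n mod s = r"
    using assms(5) q by (simp add: minus_div_mult_eq_mod [symmetric])
  have n: "real_of_int n = real_of_int q * real_of_int s + real_of_int r"
    using assms(5) by simp
  have s: "0 < real_of_int s"
    using assms(2) by simp
  have n0: "0 \<le> real_of_int n"
    using assms(1) by simp
  note lower = edge_forwarding_index_ge_cyclic'[folded C_def]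
    edge_forwarding_index_ge_sqrt[folded C_def]
  note middle = half_edge_forwarding_index_circulant2_le[folded C_def]
  have "real (arc_forwarding_index C)
      \<le> ((real_of_int n - real_of_int r) * (real_of_int n + real_of_int r + 2) + real_of_int s ^ 2)
         / (8 * real_of_int s)"
    if "real_of_int s \<le> sqrt (real_of_int n) - 1"
  proof -
    have "(real_of_int s + 1)\<^sup>2 \<le> (sqrt (real_of_int n))\<^sup>2"
      using that s by (intro power_mono) auto
    then have "real_of_int ((s + 1)\<^sup>2) \<le> real_of_int n"
      using n0 by simp
    then have "(s + 1)\<^sup>2 \<le> n"
      by (simp only: of_int_le_iff)
    from arc_forwarding_index_small_step[OF this, folded C_def, unfolded q r]
    have "real_of_int (8 * int (arc_forwarding_index C)) \<le> real_of_int (s * q\<^sup>2 + 2 * q * (r + 1) + s)"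
      by (simp only: of_int_le_iff)
    then have "8 * real (arc_forwarding_index C) \<le>
        real_of_int s * (real_of_int q)\<^sup>2 + 2 * real_of_int q * (real_of_int r + 1) + real_of_int s"
      by simp
    \<comment> \<open>Multiplying by \<open>s\<close> lets \<open>q * s = n - r\<close> eliminate
      \<open>q\<close>.\<close>
    from mult_left_mono[OF this, of "real_of_int s"] s show ?thesis
      by (simp add: n pos_le_divide_eq power2_eq_square algebra_simps)
  qed
  moreover have "sqrt (real_of_int n) * (real_of_int n - 1) / 8 \<le> real (edge_forwarding_index C) / 2 \<and>
      real (arc_forwarding_index C) \<le> sqrt (real_of_int n) * (real_of_int n - eps s) / 8"
    if "real_of_int s = sqrt (real_of_int n)"
  proof -
    have "real_of_int (s\<^sup>2) = real_of_int n"
      using that n0 by simp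
    then have square: "n = s\<^sup>2"
      by (simp only: of_int_eq_iff)
    from arc_forwarding_index_square[OF this, folded C_def]
    have "real_of_int (8 * int (arc_forwarding_index C)) \<le> real_of_int (s * (n - s mod 2))"
      by (simp only: of_int_le_iff)
    then have "8 * real (arc_forwarding_index C) \<le> real_of_int s * (real_of_int n - eps s)"
      by (simp add: eps_eq_mod)
    then show ?thesis
      using edge_forwarding_index_ge_square[OF square, folded C_def] that by simp
  qed
  moreover have "real (arc_forwarding_index C)
      \<le> (real_of_int s ^ 2 * (real_of_int n + real_of_int r + 2)
           - eps s * (real_of_int n - real_of_int r)) / (8 * real_of_int s)"
    if "sqrt (real_of_int n) + 1 \<le> real_of_int s"
  proof -
    have "(sqrt (real_of_int n))\<^sup>2 \<le> (real_of_int s - 1)\<^sup>2"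
      using that n0 by (intro power_mono) auto
    then have "real_of_int n \<le> real_of_int ((s - 1)\<^sup>2)"
      using n0 by simp
    then have "n \<le> (s - 1)\<^sup>2"
      by (simp only: of_int_le_iff)
    from arc_forwarding_index_large_step[OF this, folded C_def, unfolded q r]
    have "real_of_int (8 * int (arc_forwarding_index C)) \<le>
        real_of_int (q * (s\<^sup>2 - s mod 2) + 2 * s * (r + 1))"
      by (simp only: of_int_le_iff)
    then have "8 * real (arc_forwarding_index C) \<le>
        real_of_int q * ((real_of_int s)\<^sup>2 - eps s) + 2 * real_of_int s * (real_of_int r + 1)"
      by (simp add: eps_eq_mod)
    from mult_left_mono[OF this, of "real_of_int s"] s show ?thesis
      by (simp add: n pos_le_divide_eq power2_eq_square algebra_simps)
  qed
  ultimately show ?thesis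
    using lower middle unfolding max.bounded_iff by blast
qed

end
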